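(* Let $B$ be a real symmetric positive definite $n\times n$ matrix, and consider the flat torus $\mathbb{T}^n=\mathbb{R}^n/\mathbb{Z}^n$ with the metric $(x,y)_B=\langle Bx,y\rangle$. Let $\mathcal{V}$ be a finite set of vectors in $\mathbb{R}^n$ such that $Bv\in\mathbb{Z}^n$ for every $v\in\mathcal{V}$ and $v+w\neq0$ for all $v,w\in\mathcal{V}$. Let $\{a_v\}_{v\in\mathcal{V}}$ be a uniformly random point of the sphere of radius $\sqrt2$ in $\mathbb{R}^{\mathcal{V}}$, and define the random function $$f(x)=\mathrm{Re}\left(\sum_{v\in\mathcal{V}}a_v e^{2\pi i\langle Bv,x\rangle}\right).$$ Let $\mu_v=(2\pi\|v\|_B)^2$ where $\|v\|_B^2=(v,v)_B$. Let $X$ be a uniformly random point of $\mathbb{T}^n$ (independent of the $a_v$) and $Z$ a standard Gaussian random variable. Then for every $\mu>0$, $$\mathbb{E}\,d_{TV}(f(X),Z)\le\frac{1}{\mu}\left[\sqrt{\frac{8(2\pi)^4}{|\mathcal{V}|(|\mathcal{V}|+2)}\sum_{v,w\in\mathcal{V}}(v,w)_B^2}+\left(2\sqrt2+\sqrt\pi\right)\sqrt{\frac{1}{|\mathcal{V}|}\sum_{v\in\mathcal{V}}(\mu_v-\mu)^2}\right],$$ where $d_{TV}(f(X),Z)$ is computed for fixed coefficients $\{a_v\}$ and the expectation is over the random coefficients.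
   Context: $d_{TV}(X,Y)=\sup_A|\mathbb{P}(X\in A)-\mathbb{P}(Y\in A)|$ over measurable $A$. With the metric $(\cdot,\cdot)_B$, the Laplacian on the torus is $\Delta_Bf=\sum_{j,k}(B^{-1})_{jk}\partial_j\partial_kf$, and $e^{2\pi i\langle Bv,x\rangle}$ (for $Bv\in\mathbb{Z}^n$) has eigenvalue $-\mu_v$. *)

theory Defs
  imports "HOL-Probability.Probability"
begin

definition dTV :: "real measure \<Rightarrow> real measure \<Rightarrow> real" where
  "dTV M N = (SUP A \<in> sets borel. \<bar>measure M A - measure N A\<bar>)"

definition std_gaussian :: "real measure" where
  "std_gaussian = density lborel std_normal_density"

definition innerB :: "real^'n^'n \<Rightarrow> real^'n \<Rightarrow> real^'n \<Rightarrow> real" where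
  "innerB B x y = (B *v x) \<bullet> y"

text \<open>Uniform (normalized surface = cone) measure on the sphere of radius r in R^V,
  points of R^V being functions on V (extensional).  It is obtained as the image of the
  uniform distribution on the closed unit ball under radial projection y \<mapsto> r y / |y|.\<close>
definition sphere_unif :: "'a set \<Rightarrow> real \<Rightarrow> ('a \<Rightarrow> real) measure" where
  "sphere_unif V r =
     distr (uniform_measure (PiM V (\<lambda>_. lborel))
              {y \<in> space (PiM V (\<lambda>_. lborel)). (\<Sum>v\<in>V. (y v)\<^sup>2) \<le> 1})
           (PiM V (\<lambda>_. borel))
           (\<lambda>y. restrict (\<lambda>v. r / sqrt (\<Sum>u\<in>V. (y u)\<^sup>2) * y v) V)"

text \<open>Uniform point of the torus R^n/Z^n, represented on the fundamental domain [0,1]^n.\<close>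
definition torus_unif :: "(real^'n) measure" where
  "torus_unif = uniform_measure lborel (cbox 0 1)"

definition wave :: "real^'n^'n \<Rightarrow> (real^'n) set \<Rightarrow> (real^'n \<Rightarrow> real) \<Rightarrow> real^'n \<Rightarrow> real" where
  "wave B V a x = Re (\<Sum>v\<in>V. complex_of_real (a v) *
                        exp (\<i> * complex_of_real (2 * pi * ((B *v v) \<bullet> x))))"

end

theory Submission
  imports Defs
begin

text \<open>
  Stein's method. For continuous \<open>g\<close> with values in \<open>[0,1]\<close>, the bounded solution \<open>h\<close> of
  \<open>h'(x) - x h(x) = g(x) - \<bbbE> g(Z)\<close> satisfies \<open>\<bar>h'\<bar> \<le> 2\<close> and \<open>\<bar>h\<bar> \<le> \<surd>(2\<pi>)\<close>. Integration by parts on the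
  torus gives \<open>\<bbbE> h'(f) \<parallel>\<nabla>f\<parallel>\<^sup>2 = - \<bbbE> h(f) \<Delta>f\<close>, hence for fixed coefficients
  \<open>\<mu> d\<^sub>T\<^sub>V(f(X), Z) \<le> 2 \<bbbE> \<bar>\<parallel>\<nabla>f\<parallel>\<^sup>2 - \<mu>\<bar> + \<surd>(2\<pi>) \<bbbE> \<bar>\<Delta>f + \<mu> f\<bar>\<close>.
  Both terms are controlled by second moments over \<open>X\<close>, which are polynomials in the \<open>a\<^sub>v\<close>; their
  expectations only involve the second and fourth moments of the sphere, and those follow from its
  invariance under sign changes and under \<open>(s, t) \<mapsto> ((s + t)/\<surd>2, (s - t)/\<surd>2)\<close> in two coordinates.
  Comparing \<open>\<parallel>\<nabla>f\<parallel>\<^sup>2\<close> with its mean over the torus for the given \<open>a\<close>, rather than with its overall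
  mean, is what makes the constant \<open>8\<close> come out. The constants fit because
  \<open>2 + \<surd>(2\<pi>) \<le> 2\<surd>2 + \<surd>\<pi>\<close>.
\<close>

section \<open>Stein's equation\<close>

lemma std_normal_density_has_derivative:
  "(std_normal_density has_real_derivative - x * std_normal_density x) (at x)"
  unfolding std_normal_density_def
  by (rule derivative_eq_intros refl | simp)+

lemma continuous_std_normal_density [continuous_intros]:
  "continuous_on S std_normal_density"
  unfolding std_normal_density_def by (intro continuous_intros) auto

text \<open>The first bound rests on \<open>t^2 >= x^2 + (t - x)^2\<close> for
  \<open>t >= x >= 0\<close>, which dominates the tail by a multiple of a translated density; the
  second on \<open>x <= t\<close> over the tail and the explicit antiderivative of
  \<open>t * std_normal_density t\<close>.\<close>

lemma gaussian_tail:
  fixes x :: real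
  assumes "0 \<le> x"
  defines "T \<equiv> \<integral>t. indicator {x..} t * std_normal_density t \<partial>lborel"
  shows "T \<le> sqrt (2 * pi) * std_normal_density x"
    and "x * T \<le> std_normal_density x"
proof -
  let ?\<phi> = std_normal_density
  have int_tail: "integrable lborel (\<lambda>t. indicator {x..} t * ?\<phi> t)"
    using integrable_mult_indicator[of "{x..}" lborel ?\<phi>] by simp
  have int_shift: "integrable lborel (\<lambda>t. ?\<phi> (t - x))"
    using lborel_integrable_real_affine[of ?\<phi> 1 "-x"] by simp
  have shift: "(\<integral>t. ?\<phi> (t - x) \<partial>lborel) = 1"
    using lborel_integral_real_affine[of 1 ?\<phi> "-x"] by simp
  \<comment> \<open>Integrating the translated density over the whole line rather than the half-line
    loses a factor 2, which the final constants absorb.\<close>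
  have "T \<le> (\<integral>t. sqrt (2 * pi) * ?\<phi> x * ?\<phi> (t - x) \<partial>lborel)"
    unfolding T_def
  proof (intro integral_mono int_tail integrable_mult_right int_shift)
    fix t
    show "indicator {x..} t * ?\<phi> t \<le> sqrt (2 * pi) * ?\<phi> x * ?\<phi> (t - x)"
    proof (cases "x \<le> t")
      case True
      have "x * x \<le> t * x" using True assms by (intro mult_right_mono) auto
      then have "- t\<^sup>2 / 2 \<le> - x\<^sup>2 / 2 + - (t - x)\<^sup>2 / 2"
        by (simp add: power2_eq_square algebra_simps)
      then have "exp (- t\<^sup>2 / 2) \<le> exp (- x\<^sup>2 / 2) * exp (- (t - x)\<^sup>2 / 2)"
        unfolding exp_add[symmetric] by simp
      then show ?thesis using True by (simp add: std_normal_density_def divide_right_mono)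
    qed (simp add: mult_nonneg_nonneg)
  qed
  also have "\<dots> = sqrt (2 * pi) * ?\<phi> x" by (simp add: shift)
  finally show "T \<le> sqrt (2 * pi) * ?\<phi> x" .
  have "(\<integral>\<^sup>+t. ennreal (t * ?\<phi> t) * indicator {x..} t \<partial>lborel) = ennreal (0 - (- ?\<phi> x))"
  proof (rule nn_integral_FTC_atLeast)
    show "((\<lambda>t. - ?\<phi> t) has_real_derivative t * ?\<phi> t) (at t)" for t
      using DERIV_minus[OF std_normal_density_has_derivative[of t]] by simp
    have "((\<lambda>t::real. - (1 / sqrt (2 * pi) * exp (- t\<^sup>2 / 2))) \<longlongrightarrow> - (1 / sqrt (2 * pi) * 0)) at_top"
    proof (intro tendsto_intros filterlim_compose[OF exp_at_bot])
      have "filterlim (\<lambda>t::real. t\<^sup>2 * (1/2)) at_top at_top"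
        by (rule filterlim_at_top_mult_tendsto_pos[where c = "1/2"])
          (auto intro!: filterlim_pow_at_top filterlim_ident)
      then show "filterlim (\<lambda>t::real. - t\<^sup>2 / 2) at_bot at_top"
        by (simp add: filterlim_uminus_at_top)
    qed
    then show "((\<lambda>t. - ?\<phi> t) \<longlongrightarrow> 0) at_top" by (simp add: std_normal_density_def)
  qed (use assms in \<open>auto\<close>)
  then have nn: "(\<integral>\<^sup>+t. ennreal (indicator {x..} t * (t * ?\<phi> t)) \<partial>lborel) = ennreal (?\<phi> x)"
    by (subst (asm) nn_integral_cong[where v = "\<lambda>t. ennreal (indicator {x..} t * (t * ?\<phi> t))"])
      (auto simp: indicator_def)
  have "ennreal (x * T) = (\<integral>\<^sup>+t. ennreal (x * (indicator {x..} t * ?\<phi> t)) \<partial>lborel)"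
    unfolding T_def
    by (subst nn_integral_eq_integral) (auto intro!: integrable_mult_right int_tail mult_nonneg_nonneg assms)
  also have "\<dots> \<le> (\<integral>\<^sup>+t. ennreal (indicator {x..} t * (t * ?\<phi> t)) \<partial>lborel)"
    by (intro nn_integral_mono ennreal_leI) (auto simp: indicator_def intro!: mult_right_mono)
  finally show "x * T \<le> ?\<phi> x" by (simp add: nn)
qed

text \<open>\<open>h\<close> is the integral of \<open>(g - m)\<close> times the density over the
  left tail, divided by the density. The total integral vanishes, so the tail pointing away from 0
  may be used; with \<open>|g - m| <= 1\<close>, \<open>gaussian_tail\<close> bounds both
  \<open>h\<close> and \<open>x * h\<close>, and the equation then bounds \<open>h'\<close>.\<close>

lemma stein_solution:
  fixes g :: "real \<Rightarrow> real"
  assumes contg: "continuous_on UNIV g" and g01: "\<And>x. 0 \<le> g x" "\<And>x. g x \<le> 1"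
  obtains h h' :: "real \<Rightarrow> real" where
    "continuous_on UNIV h'"
    "\<And>x. (h has_real_derivative h' x) (at x)"
    "\<And>x. h' x - x * h x = g x - (\<integral>t. g t \<partial>std_gaussian)"
    "\<And>x. \<bar>h x\<bar> \<le> sqrt (2 * pi)"
    "\<And>x. \<bar>h' x\<bar> \<le> 2"
proof -
  let ?\<phi> = std_normal_density
  define m where "m = (\<integral>t. g t \<partial>std_gaussian)"
  define k where "k t = (g t - m) * ?\<phi> t" for t
  have [measurable]: "g \<in> borel_measurable borel"
    using contg by (rule borel_measurable_continuous_onI)
  have \<phi>_pos: "?\<phi> x > 0" for x by (rule normal_density_pos) simp
  have m_eq: "m = (\<integral>t. g t * ?\<phi> t \<partial>lborel)"
    unfolding m_def std_gaussian_def by (subst integral_density) (auto simp: mult.commute)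
  have int_g: "integrable lborel (\<lambda>t. g t * ?\<phi> t)"
    by (rule Bochner_Integration.integrable_bound[of _ ?\<phi>]) (auto simp: abs_mult g01 mult_left_le_one_le)
  have "0 \<le> m" unfolding m_eq by (intro integral_nonneg_AE) (auto simp: g01)
  have "m \<le> (\<integral>t. ?\<phi> t \<partial>lborel)"
    unfolding m_eq by (intro integral_mono int_g) (auto simp: g01 mult_left_le_one_le)
  then have "m \<le> 1" by simp
  have gm: "\<bar>g t - m\<bar> \<le> 1" for t using g01[of t] \<open>0 \<le> m\<close> \<open>m \<le> 1\<close> by (simp add: abs_le_iff)
  have k_le: "\<bar>k t\<bar> \<le> ?\<phi> t" for t
    unfolding k_def by (simp add: abs_mult gm mult_left_le_one_le)
  have contk: "continuous_on S k" for S
    unfolding k_def by (intro continuous_intros continuous_on_subset[OF contg]) auto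
  have int_k: "integrable lborel k"
    unfolding k_def left_diff_distrib by (intro Bochner_Integration.integrable_diff int_g integrable_mult_right) auto
  have k0: "(\<integral>t. k t \<partial>lborel) = 0"
    unfolding k_def left_diff_distrib by (subst Bochner_Integration.integral_diff) (auto simp: int_g m_eq)
  have int_kS: "integrable lborel (\<lambda>t. indicator S t * k t)" if "S \<in> sets borel" for S
    using integrable_mult_indicator[of S lborel k] that int_k by simp
  define G where "G x = (\<integral>t. indicator {..x} t * k t \<partial>lborel)" for x
  have G_deriv: "(G has_real_derivative k x) (at x)" for x
  proof -
    \<comment> \<open>A base point left of \<open>x\<close> turns \<open>G\<close> near
      \<open>x\<close> into a constant plus an integral over a compact interval, to which the
      fundamental theorem of calculus applies.\<close>
    define c where "c = G (x - 1)"
    have eq: "G y = c + integral {x-1..y} k" if "y \<in> {x-1<..<x+1}" for y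
    proof -
      have sint: "set_integrable lborel {x-1..y} k"
        using int_kS[of "{x-1..y}"] by (simp add: set_integrable_def)
      have "G y = (\<integral>t. indicator {..x-1} t * k t + indicator {x-1<..y} t * k t \<partial>lborel)"
        unfolding G_def using that by (intro Bochner_Integration.integral_cong) (auto simp: indicator_def)
      also have "\<dots> = c + (\<integral>t. indicator {x-1<..y} t * k t \<partial>lborel)"
        unfolding c_def G_def by (intro Bochner_Integration.integral_add int_kS) auto
      also have "(\<integral>t. indicator {x-1<..y} t * k t \<partial>lborel) = (\<integral>t. indicator {x-1..y} t * k t \<partial>lborel)"
      proof (rule integral_cong_AE)
        show "AE t in lborel. indicator {x-1<..y} t * k t = indicator {x-1..y} t * k t"
          using AE_lborel_singleton[of "x-1"] by eventually_elim (auto simp: indicator_def)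
      qed (use int_k in auto)
      also have "\<dots> = integral {x-1..y} k"
        using set_borel_integral_eq_integral(2)[OF sint] by (simp add: set_lebesgue_integral_def)
      finally show ?thesis .
    qed
    have "((\<lambda>y. integral {x-1..y} k) has_real_derivative k x) (at x within {x-1..x+1})"
      by (rule integral_has_real_derivative[OF contk]) auto
    then have "((\<lambda>y. integral {x-1..y} k) has_real_derivative k x) (at x)"
      by (simp add: at_within_Icc_at)
    then have "((\<lambda>y. c + integral {x-1..y} k) has_real_derivative k x) (at x)"
      by (auto intro!: derivative_eq_intros)
    then show ?thesis
      by (rule DERIV_cong_ev[OF refl _ refl, THEN iffD1, rotated])
        (use eq in \<open>auto simp: eventually_nhds intro!: exI[of _ "{x-1<..<x+1}"]\<close>)
  qed
  define h where "h x = G x / ?\<phi> x" for x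
  \<comment> \<open>Read off from the equation, so that the equation and continuity are immediate;
    the quotient rule identifies it as the derivative, since the density satisfies
    \<open>phi' = - x * phi\<close>.\<close>
  define h' where "h' x = x * h x + (g x - m)" for x
  have h_deriv: "(h has_real_derivative h' x) (at x)" for x
    unfolding h_def[abs_def]
    by (rule derivative_eq_intros G_deriv std_normal_density_has_derivative)+
      (use \<phi>_pos[of x] in \<open>auto simp: h'_def h_def k_def field_simps\<close>)
  define T where "T x = (\<integral>t. indicator {x..} t * ?\<phi> t \<partial>lborel)" for x
  have int_\<phi>S: "integrable lborel (\<lambda>t. indicator S t * ?\<phi> t)" if "S \<in> sets borel" for S
    using integrable_mult_indicator[of S lborel ?\<phi>] that by simp
  have absint: "\<bar>\<integral>t. indicator S t * k t \<partial>lborel\<bar> \<le> (\<integral>t. indicator S t * ?\<phi> t \<partial>lborel)"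
    if "S \<in> sets borel" for S
    using Bochner_Integration.integral_norm_bound_integral[OF int_kS[OF that] int_\<phi>S[OF that]] k_le
    by (auto simp: indicator_def abs_mult)
  \<comment> \<open>For \<open>x >= 0\<close> the vanishing total integral trades the left tail for
    the right one; for \<open>x < 0\<close> the left tail is reflected, the density being
    even.\<close>
  have GT: "\<bar>G x\<bar> \<le> T \<bar>x\<bar>" for x
  proof (cases "0 \<le> x")
    case True
    have "(\<integral>t. k t \<partial>lborel) = (\<integral>t. indicator {..x} t * k t + indicator {x<..} t * k t \<partial>lborel)"
      by (intro Bochner_Integration.integral_cong) (auto simp: indicator_def)
    also have "\<dots> = G x + (\<integral>t. indicator {x<..} t * k t \<partial>lborel)"
      unfolding G_def by (intro Bochner_Integration.integral_add int_kS) auto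
    finally have "\<bar>G x\<bar> = \<bar>\<integral>t. indicator {x<..} t * k t \<partial>lborel\<bar>" by (simp add: k0)
    also have "\<dots> \<le> (\<integral>t. indicator {x<..} t * ?\<phi> t \<partial>lborel)" by (rule absint) simp
    also have "\<dots> \<le> T x"
      unfolding T_def by (intro integral_mono int_\<phi>S) (auto simp: indicator_def)
    finally show ?thesis using True by simp
  next
    case False
    have "\<bar>G x\<bar> \<le> (\<integral>t. indicator {..x} t * ?\<phi> t \<partial>lborel)" unfolding G_def by (rule absint) simp
    also have "\<dots> = (\<integral>t. indicator {..x} (-t) * ?\<phi> (-t) \<partial>lborel)"
      using lborel_integral_real_affine[of "-1" "\<lambda>t. indicator {..x} t * ?\<phi> t" 0] by simp
    also have "\<dots> = T (-x)"
      unfolding T_def std_normal_density_def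
      by (intro Bochner_Integration.integral_cong) (auto simp: indicator_def)
    finally show ?thesis using False by simp
  qed
  have h_le: "\<bar>h x\<bar> \<le> sqrt (2 * pi)" for x
  proof -
    have "\<bar>G x\<bar> \<le> sqrt (2 * pi) * ?\<phi> \<bar>x\<bar>"
      using GT[of x] gaussian_tail(1)[of "\<bar>x\<bar>"] by (simp add: T_def)
    also have "?\<phi> \<bar>x\<bar> = ?\<phi> x" by (simp add: std_normal_density_def)
    finally show ?thesis using \<phi>_pos[of x] by (simp add: h_def pos_divide_le_eq)
  qed
  have xh_le: "\<bar>x * h x\<bar> \<le> 1" for x
  proof -
    have "\<bar>x\<bar> * \<bar>G x\<bar> \<le> \<bar>x\<bar> * T \<bar>x\<bar>" using GT[of x] by (intro mult_left_mono) auto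
    also have "\<dots> \<le> ?\<phi> \<bar>x\<bar>" using gaussian_tail(2)[of "\<bar>x\<bar>"] by (simp add: T_def)
    also have "\<dots> = ?\<phi> x" by (simp add: std_normal_density_def)
    finally show ?thesis using \<phi>_pos[of x] by (simp add: h_def abs_mult)
  qed
  have conth: "continuous_on UNIV h" using h_deriv by (meson DERIV_continuous_on DERIV_subset subset_UNIV)
  show thesis
  proof (rule that[of h' h])
    show "continuous_on UNIV h'"
      unfolding h'_def by (intro continuous_intros conth contg)
    show "\<bar>h' x\<bar> \<le> 2" for x using xh_le[of x] gm[of x] by (simp add: h'_def)
    show "(h has_real_derivative h' x) (at x)" for x by (rule h_deriv)
    show "\<bar>h x\<bar> \<le> sqrt (2 * pi)" for x by (rule h_le)
  qed (simp add: h'_def m_def)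
qed

section \<open>Total variation via continuous test functions\<close>

text \<open>Continuous functions of the distance to \<open>K\<close> decrease to its indicator, and
  dominated convergence carries the estimate over. \<open>K\<close> has to be nonempty because
  \<open>infdist x {}\<close> is 0, which would make the approximants constantly 1.\<close>

lemma closed_measure_diff_le:
  fixes M N :: "real measure"
  assumes M: "prob_space M" "sets M = sets borel" and N: "prob_space N" "sets N = sets borel"
    and le: "\<And>g. continuous_on UNIV g \<Longrightarrow> (\<And>x. 0 \<le> g x \<and> g x \<le> 1) \<Longrightarrow>
           \<bar>(\<integral>x. g x \<partial>M) - (\<integral>x. g x \<partial>N)\<bar> \<le> C"
    and K: "closed K" "K \<noteq> {}"
  shows "\<bar>measure M K - measure N K\<bar> \<le> C"
proof -
  define g where "g n x = max 0 (1 - real n * infdist x K)" for n x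
  have contg: "continuous_on UNIV (g n)" for n
    unfolding g_def by (intro continuous_intros)
  have g01: "0 \<le> g n x \<and> g n x \<le> 1" for n x
    by (auto simp: g_def infdist_nonneg)
  have lim: "(\<lambda>n. g n x) \<longlonglongrightarrow> indicator K x" for x
  proof (cases "x \<in> K")
    case True
    then show ?thesis by (simp add: g_def)
  next
    case False
    then have pos: "infdist x K > 0" using K in_closed_iff_infdist_zero[of K x] infdist_nonneg[of x K] by simp
    obtain n0 where "real n0 * infdist x K > 1" using pos reals_Archimedean3 by blast
    then have "g n x = 0" if "n \<ge> n0" for n
      using that mult_right_mono[of "real n0" "real n" "infdist x K"] pos
      unfolding g_def by (intro max_absorb1) linarith
    then show ?thesis using False by (auto intro!: tendsto_eventually eventually_sequentiallyI[of n0])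
  qed
  have conv: "(\<lambda>n. \<integral>x. g n x \<partial>P) \<longlonglongrightarrow> measure P K" if P: "prob_space P" "sets P = sets borel" for P
  proof -
    interpret P: prob_space P by fact
    have [measurable]: "g n \<in> borel_measurable P" for n
      using borel_measurable_continuous_onI[OF contg] P by (simp cong: measurable_cong_sets)
    have [measurable]: "K \<in> sets P" using P K by simp
    have "(\<lambda>n. \<integral>x. g n x \<partial>P) \<longlonglongrightarrow> (\<integral>x. indicator K x \<partial>P)"
      by (rule integral_dominated_convergence[where w = "\<lambda>_. 1"]) (use lim g01 in auto)
    moreover have "space P = UNIV" using P(2) by (metis sets_eq_imp_space_eq space_borel)
    ultimately show ?thesis by simp
  qed
  have "(\<lambda>n. \<bar>(\<integral>x. g n x \<partial>M) - (\<integral>x. g n x \<partial>N)\<bar>) \<longlonglongrightarrow> \<bar>measure M K - measure N K\<bar>"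
    by (intro tendsto_intros conv M N)
  then show ?thesis
    by (rule LIMSEQ_le_const2) (use le[OF contg] g01 in blast)
qed

text \<open>Inner regularity reduces Borel sets to compact ones: some compact subset of
  \<open>A\<close> has almost all of the \<open>P\<close>-mass of \<open>A\<close> and at most its
  \<open>Q\<close>-mass.\<close>

lemma dTV_le_continuous:
  fixes M N :: "real measure"
  assumes M: "prob_space M" "sets M = sets borel" and N: "prob_space N" "sets N = sets borel"
    and le: "\<And>g. continuous_on UNIV g \<Longrightarrow> (\<And>x. 0 \<le> g x \<and> g x \<le> 1) \<Longrightarrow>
           \<bar>(\<integral>x. g x \<partial>M) - (\<integral>x. g x \<partial>N)\<bar> \<le> C"
  shows "dTV M N \<le> C"
proof -
  have "0 \<le> C" using le[of "\<lambda>_. 0"] by simp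
  \<comment> \<open>Inner approximation controls one sign of the difference, so the claim is stated
    for a generic pair and applied in both orders.\<close>
  have one_sided: "measure P A - measure Q A \<le> C"
    if P: "prob_space P" "sets P = sets borel" and Q: "prob_space Q" "sets Q = sets borel"
      and PQ: "\<And>K. closed K \<Longrightarrow> K \<noteq> {} \<Longrightarrow> \<bar>measure P K - measure Q K\<bar> \<le> C"
      and A: "A \<in> sets borel" for P Q :: "real measure" and A
  proof (rule field_le_epsilon)
    fix e :: real assume e: "e > 0"
    interpret P: prob_space P by fact
    interpret Q: prob_space Q by fact
    show "measure P A - measure Q A \<le> C + e"
    \<comment> \<open>\<open>ennreal\<close> truncates negative numbers to 0, so the strict
      inequality that produces \<open>K\<close> is only safe when \<open>measure P A - e\<close> is
      nonnegative.\<close>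
    proof (cases "measure P A < e")
      case True
      then show ?thesis using \<open>0 \<le> C\<close> measure_nonneg[of Q A] by linarith
    next
      case False
      then have "ennreal (measure P A - e) < emeasure P A"
        using e by (simp add: P.emeasure_eq_measure ennreal_less_iff)
      also have "emeasure P A = (SUP K \<in> {K. K \<subseteq> A \<and> compact K}. emeasure P K)"
        by (rule inner_regular) (use P A in auto)
      finally obtain K where K: "K \<subseteq> A" "compact K" "ennreal (measure P A - e) < emeasure P K"
        by (auto simp: less_SUP_iff)
      then have "measure P A - e < measure P K" using False
        by (simp add: P.emeasure_eq_measure ennreal_less_iff)
      moreover have "measure Q K \<le> measure Q A" using K A Q by (intro Q.finite_measure_mono) auto
      moreover have "measure P K - measure Q K \<le> C"
      proof (cases "K = {}")
        case False
        then show ?thesis using PQ[OF compact_imp_closed[OF K(2)]] by (simp add: abs_le_iff)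
      qed (simp add: \<open>0 \<le> C\<close>)
      ultimately show ?thesis by linarith
    qed
  qed
  have closed: "\<bar>measure M K - measure N K\<bar> \<le> C" if "closed K" "K \<noteq> {}" for K
    using closed_measure_diff_le[OF M N le that] .
  have "\<bar>measure M A - measure N A\<bar> \<le> C" if "A \<in> sets borel" for A
  proof -
    have "measure M A - measure N A \<le> C" by (rule one_sided[OF M N closed that])
    moreover have "measure N A - measure M A \<le> C"
      by (rule one_sided[OF N M _ that]) (subst abs_minus_commute, rule closed)
    ultimately show ?thesis by (simp add: abs_le_iff)
  qed
  then show ?thesis unfolding dTV_def by (intro cSUP_least) auto
qed

section \<open>Periodic functions on the torus\<close>

text \<open>An exact fundamental domain for integer translations: its indicator can be cut and
  reassembled pointwise, whereas the closed cube meets its translates along faces.\<close>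

definition half_open_cube :: "(real^'n) set" where
  "half_open_cube = {x. \<forall>i. 0 \<le> x $ i \<and> x $ i < 1}"

lemma half_open_cube_measurable [measurable]: "half_open_cube \<in> sets borel"
proof -
  have "half_open_cube = (\<Inter>i. {x::real^'n. 0 \<le> x $ i} \<inter> {x. x $ i < 1})"
    by (auto simp: half_open_cube_def)
  also have "\<dots> \<in> sets borel"
    by (intro sets.countable_INT'' sets.Int borel_closed borel_open closed_Collect_le open_Collect_less
        continuous_intros) auto
  finally show ?thesis .
qed

lemma emeasure_unit_cube: "emeasure lborel (cbox 0 1 :: (real^'n) set) = 1"
proof -
  have "(\<Prod>b\<in>Basis. (1 - 0 :: real^'n) \<bullet> b) = 1"
    by (rule prod.neutral) (auto simp: Basis_vec_def inner_axis)
  moreover have "\<forall>b\<in>Basis. (0::real^'n) \<bullet> b \<le> 1 \<bullet> b"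
    by (auto simp: Basis_vec_def inner_axis)
  ultimately show ?thesis by (simp add: emeasure_lborel_cbox_eq)
qed

lemma torus_unif_eq_density: "torus_unif = density lborel (\<lambda>x. ennreal (indicator (cbox 0 1) x))"
  unfolding torus_unif_def uniform_measure_def emeasure_unit_cube
  by (simp add: ennreal_indicator divide_ennreal_def)

lemma prob_space_torus_unif: "prob_space torus_unif"
  unfolding torus_unif_def by (rule prob_space_uniform_measure) (auto simp: emeasure_unit_cube)

lemma sets_torus_unif [measurable_cong, simp]: "sets torus_unif = sets borel"
  by (simp add: torus_unif_def)

lemma space_torus_unif [simp]: "space torus_unif = UNIV"
  by (simp add: torus_unif_def)

lemma measure_torus_UNIV [simp]: "measure torus_unif UNIV = 1"
  using prob_space.prob_space[OF prob_space_torus_unif] by simp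

lemma torus_integral_cbox:
  fixes F :: "real^'n \<Rightarrow> real"
  assumes [measurable]: "F \<in> borel_measurable borel"
  shows "(\<integral>x. F x \<partial>torus_unif) = (\<integral>x. indicator (cbox 0 1) x * F x \<partial>lborel)"
  unfolding torus_unif_eq_density by (subst integral_density) auto

text \<open>The two cubes differ only within the boundary, a null set because the open and the
  closed cube have equal volume.\<close>

lemma torus_integral_half_open:
  fixes F :: "real^'n \<Rightarrow> real"
  assumes [measurable]: "F \<in> borel_measurable borel"
  shows "(\<integral>x. F x \<partial>torus_unif) = (\<integral>x. indicator half_open_cube x * F x \<partial>lborel)"
  unfolding torus_integral_cbox[OF assms]
proof (rule integral_cong_AE)
  have "emeasure lborel (cbox 0 1 - box 0 1 :: (real^'n) set)
      = emeasure lborel (cbox 0 1 :: (real^'n) set) - emeasure lborel (box 0 1 :: (real^'n) set)"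
    by (rule emeasure_Diff) (auto simp: box_subset_cbox emeasure_lborel_box_eq)
  also have "emeasure lborel (box 0 1 :: (real^'n) set) = 1"
    using emeasure_unit_cube[where 'n='n] by (simp add: emeasure_lborel_box_eq emeasure_lborel_cbox_eq)
  finally have "emeasure lborel (cbox 0 1 - box 0 1 :: (real^'n) set) = 0"
    by (simp add: emeasure_unit_cube)
  then have "AE x in lborel. x \<notin> (cbox 0 1 - box 0 1 :: (real^'n) set)"
    by (intro AE_not_in) auto
  then show "AE x in lborel. indicator (cbox 0 1) x * F x = indicator half_open_cube x * F x"
    by eventually_elim
      (auto simp: indicator_def half_open_cube_def mem_box_cart less_imp_le order.strict_implies_order)
qed auto

lemma torus_integral_henstock:
  fixes F :: "real^'n \<Rightarrow> real"
  assumes F: "continuous_on UNIV F"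
  shows "(\<integral>x. F x \<partial>torus_unif) = integral (cbox 0 1) F"
proof -
  have "set_integrable lborel (cbox 0 1) F"
    unfolding set_integrable_def
    by (rule borel_integrable_compact) (auto intro: continuous_on_subset[OF F])
  from set_borel_integral_eq_integral(2)[OF this]
  show ?thesis
    by (simp add: torus_integral_cbox borel_measurable_continuous_onI[OF F] set_lebesgue_integral_def)
qed

section \<open>Translation invariance of torus integrals of periodic functions\<close>

lemma lborel_integral_shift:
  fixes F :: "'a::euclidean_space \<Rightarrow> real"
  assumes "F \<in> borel_measurable borel"
  shows "(\<integral>x. F (x + y) \<partial>lborel) = (\<integral>x. F x \<partial>lborel)"
proof -
  have "(\<integral>x. F x \<partial>lborel) = (\<integral>x. F x \<partial>distr lborel borel ((+) y))"
    by (simp add: lborel_distr_plus)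
  also have "\<dots> = (\<integral>x. F (y + x) \<partial>lborel)" by (rule integral_distr) (use assms in auto)
  finally show ?thesis by (simp add: add.commute)
qed

text \<open>The bound supplies integrability over sets of finite measure. As a locale, the results
  can be instantiated again for translates of \<open>F\<close>, through
  \<open>shift\<close>.\<close>

locale periodic =
  fixes F :: "real^'n \<Rightarrow> real" and b :: real
  assumes measurable_F [measurable]: "F \<in> borel_measurable borel"
    and bounded: "\<And>x. \<bar>F x\<bar> \<le> b"
    and period: "\<And>x j. F (x + axis j 1) = F x"
begin

lemma shift: "periodic (\<lambda>x. F (x + y)) b"
proof
  show "(\<lambda>x. F (x + y)) \<in> borel_measurable borel" by measurable
  show "\<bar>F (x + y)\<bar> \<le> b" for x by (rule bounded)
  show "F (x + axis j 1 + y) = F (x + y)" for x j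
    using period[of "x + y" j] by (simp add: algebra_simps)
qed

lemma period_int: "F (x + axis j (of_int k)) = F x"
proof (induction k arbitrary: x rule: int_induct[of _ 0])
  case (step1 i)
  have "x + axis j (of_int (i + 1)) = (x + axis j 1) + axis j (of_int i)"
    by (simp add: vec_eq_iff axis_def)
  then show ?case using step1(2)[of "x + axis j 1"] period[of x j] by metis
next
  case (step2 i)
  have "x = x - axis j 1 + axis j 1" by simp
  then have "F x = F (x - axis j 1)" by (metis period)
  moreover have "x + axis j (of_int (i - 1)) = (x - axis j 1) + axis j (of_int i)"
    by (simp add: vec_eq_iff axis_def)
  ultimately show ?case using step2(2)[of "x - axis j 1"] by metis
qed (simp add: axis_def zero_vec_def[symmetric])

text \<open>The cube translated by \<open>t\<close> along axis \<open>j\<close> is the union of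
  \<open>A\<close>, the part of the cube with coordinate at least \<open>t\<close>, and the unit
  translate of the remaining slab \<open>C\<close>; periodicity moves that translate back.\<close>

lemma integral_shift_axis_unit:
  assumes t: "0 \<le> t" "t \<le> 1"
  shows "(\<integral>x. F (x + axis j t) \<partial>torus_unif) = (\<integral>x. F x \<partial>torus_unif)"
proof -
  let ?H = "half_open_cube :: (real^'n) set"
  define A where "A = ?H \<inter> {x. t \<le> x $ j}"
  define C where "C = ?H \<inter> {x. x $ j < t}"
  have [measurable]: "A \<in> sets borel" "C \<in> sets borel"
    unfolding A_def C_def
    by (auto intro!: sets.Int borel_closed borel_open closed_Collect_le open_Collect_less continuous_intros)
  have memH: "y \<in> ?H \<longleftrightarrow> (\<forall>i. i \<noteq> j \<longrightarrow> 0 \<le> y $ i \<and> y $ i < 1) \<and> 0 \<le> y $ j \<and> y $ j < 1" for y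
    unfolding half_open_cube_def by (auto intro: allE[of _ j])
  have split1: "indicator ?H (x - axis j t) = (indicator A x + indicator C (x - axis j 1) :: real)" for x
  proof (cases "\<forall>i. i \<noteq> j \<longrightarrow> 0 \<le> x $ i \<and> x $ i < 1")
    case True
    then have "x - axis j s \<in> ?H \<longleftrightarrow> 0 \<le> x $ j - s \<and> x $ j - s < 1" for s
      unfolding memH by (simp add: axis_def)
    moreover from True have "x \<in> ?H \<longleftrightarrow> 0 \<le> x $ j \<and> x $ j < 1" unfolding memH by simp
    ultimately show ?thesis using t by (auto simp: indicator_def A_def C_def axis_def)
  next
    case False
    then have "x - axis j s \<notin> ?H" for s unfolding memH by (auto simp: axis_def)
    moreover from False have "x \<notin> ?H" unfolding memH by blast
    ultimately show ?thesis by (simp add: indicator_def A_def C_def)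
  qed
  have split2: "indicator ?H x = (indicator A x + indicator C x :: real)" for x
    unfolding indicator_def A_def C_def by auto
  have fin: "emeasure lborel S < \<infinity>" if "S \<subseteq> cbox (0::real^'n) 1" for S
    using emeasure_mono[OF that, of lborel] emeasure_unit_cube[where 'n='n]
    by (simp add: order.strict_trans1[of _ 1])
  have sub: "A \<subseteq> cbox 0 1" "C \<subseteq> cbox 0 1"
    unfolding A_def C_def half_open_cube_def by (auto simp: mem_box_cart less_imp_le)
  have int: "integrable lborel (\<lambda>x. indicator S x * G x)"
    if "S \<in> sets borel" "S \<subseteq> cbox 0 1" "G \<in> borel_measurable borel" "\<And>x. \<bar>G x\<bar> \<le> b"
    for S and G :: "real^'n \<Rightarrow> real"
  proof (rule Bochner_Integration.integrable_bound[of lborel "\<lambda>x. b * indicator S x"])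
    show "integrable lborel (\<lambda>x. b * indicator S x)"
      using that(1) fin[OF that(2)] by (intro integrable_mult_right integrable_real_indicator) auto
  qed (use that in \<open>auto simp: indicator_def intro: order_trans[OF _ abs_ge_self]\<close>)
  have intA: "integrable lborel (\<lambda>x. indicator A x * F x)"
    and intC: "integrable lborel (\<lambda>x. indicator C x * F x)"
    by (auto intro!: int sub bounded)
  have intC': "integrable lborel (\<lambda>x. indicator C (x - axis j 1) * F x)"
  proof -
    have "integrable (distr lborel borel ((+) (axis j 1))) (\<lambda>x. indicator C (x - axis j 1) * F x)"
      by (subst integrable_distr_eq) (auto simp: add.commute[of "axis j 1"] period intC)
    then show ?thesis by (simp add: lborel_distr_plus)
  qed
  have "(\<integral>x. F (x + axis j t) \<partial>torus_unif) = (\<integral>x. indicator ?H x * F (x + axis j t) \<partial>lborel)"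
    by (rule torus_integral_half_open) measurable
  also have "\<dots> = (\<integral>x. indicator ?H (x - axis j t) * F x \<partial>lborel)"
    using lborel_integral_shift[of "\<lambda>x. indicator ?H (x - axis j t) * F x" "axis j t"] by simp
  also have "\<dots> = (\<integral>x. indicator A x * F x + indicator C (x - axis j 1) * F x \<partial>lborel)"
    by (simp add: split1 distrib_right)
  also have "\<dots> = (\<integral>x. indicator A x * F x \<partial>lborel) + (\<integral>x. indicator C (x - axis j 1) * F x \<partial>lborel)"
    by (intro Bochner_Integration.integral_add intA intC')
  also have "(\<integral>x. indicator C (x - axis j 1) * F x \<partial>lborel) = (\<integral>x. indicator C x * F x \<partial>lborel)"
    using lborel_integral_shift[of "\<lambda>x. indicator C (x - axis j 1) * F x" "axis j 1"]
    by (simp add: period)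
  also have "(\<integral>x. indicator A x * F x \<partial>lborel) + \<dots> = (\<integral>x. indicator A x * F x + indicator C x * F x \<partial>lborel)"
    by (intro Bochner_Integration.integral_add[symmetric] intA intC)
  also have "\<dots> = (\<integral>x. F x \<partial>torus_unif)"
    by (simp add: torus_integral_half_open split2 distrib_right)
  finally show ?thesis .
qed

lemma integral_shift_axis:
  "(\<integral>x. F (x + axis j t) \<partial>torus_unif) = (\<integral>x. F x \<partial>torus_unif)"
proof -
  \<comment> \<open>The integer part of \<open>t\<close> is a period, so only the fractional part
    matters.\<close>
  have "x + axis j t = x + axis j (frac t) + axis j (of_int \<lfloor>t\<rfloor>)" for x :: "real^'n"
    by (simp add: vec_eq_iff axis_def frac_def)
  then have "F (x + axis j t) = F (x + axis j (frac t))" for x by (metis period_int)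
  then show ?thesis using integral_shift_axis_unit[of "frac t" j] frac_lt_1[of t] by simp
qed

text \<open>Induction over coordinates: each step applies the one-axis result to the function
  already translated along earlier axes, which is again periodic.\<close>

lemma integral_shift: "(\<integral>x. F (x + y) \<partial>torus_unif) = (\<integral>x. F x \<partial>torus_unif)"
proof -
  have "(\<integral>x. F (x + (\<Sum>j\<in>S. axis j (y $ j))) \<partial>torus_unif) = (\<integral>x. F x \<partial>torus_unif)"
    if "finite S" for S
    using that
  proof (induction S)
    case (insert j S)
    interpret S: periodic "\<lambda>x. F (x + (\<Sum>j\<in>S. axis j (y $ j)))" b by (rule shift)
    show ?case using insert S.integral_shift_axis[of j "y $ j"] by (simp add: add.assoc)
  qed simp
  moreover have "(\<Sum>j\<in>UNIV. axis j (y $ j)) = y"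
    by (simp add: vec_eq_iff axis_def sum.delta)
  ultimately show ?thesis by (metis finite)
qed

text \<open>The divergence theorem on the torus for a constant direction: the integral of
  \<open>F (x + t *\<^sub>R v)\<close> is constant in \<open>t\<close>, and differentiation under
  the integral sign gives the integral of \<open>D\<close>.\<close>

lemma integral_directional_derivative_zero:
  assumes contF: "continuous_on UNIV F" and contD: "continuous_on UNIV D"
    and deriv: "\<And>x. ((\<lambda>t. F (x + t *\<^sub>R v)) has_real_derivative D x) (at 0)"
  shows "(\<integral>x. D x \<partial>torus_unif) = 0"
proof -
  let ?I = "\<lambda>t. integral (cbox 0 1) (\<lambda>x. F (x + t *\<^sub>R v))"
  have cont: "continuous_on UNIV (\<lambda>x. F (x + y))" for y
    by (intro continuous_on_compose2[OF contF] continuous_intros) auto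
  have "?I t = ?I 0" for t
    using integral_shift[of "t *\<^sub>R v"] by (simp add: torus_integral_henstock cont contF)
  then have "?I = (\<lambda>_. ?I 0)" by blast
  then have "(?I has_real_derivative 0) (at 0)" by (metis DERIV_const)
  moreover have "(?I has_real_derivative integral (cbox 0 1) (\<lambda>x. D (x + 0 *\<^sub>R v))) (at 0)"
  proof (rule leibniz_rule_field_derivative[where U = UNIV and fx = "\<lambda>t x. D (x + t *\<^sub>R v)"])
    fix t x
    \<comment> \<open>The hypothesis at the translated point gives the derivative at an arbitrary
      \<open>t\<close>.\<close>
    have "((\<lambda>s. F (x + t *\<^sub>R v + (s + - t) *\<^sub>R v)) has_real_derivative D (x + t *\<^sub>R v)) (at t)"
      using deriv[of "x + t *\<^sub>R v"] DERIV_shift[of "\<lambda>s. F (x + t *\<^sub>R v + s *\<^sub>R v)" _ t "-t"] by simp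
    then show "((\<lambda>t. F (x + t *\<^sub>R v)) has_real_derivative D (x + t *\<^sub>R v)) (at t)"
      by (simp add: algebra_simps)
  next
    show "(\<lambda>x. F (x + t *\<^sub>R v)) integrable_on cbox 0 1" for t
      by (intro integrable_continuous continuous_on_subset[OF cont]) auto
    show "continuous_on (UNIV \<times> cbox 0 1) (\<lambda>(t, x). D (x + t *\<^sub>R v))"
      unfolding split_beta by (intro continuous_on_compose2[OF contD] continuous_intros) auto
  qed auto
  ultimately have "0 = integral (cbox 0 1) (\<lambda>x. D (x + 0 *\<^sub>R v))" by (rule DERIV_unique)
  then have "integral (cbox 0 1) D = 0" by simp
  then show ?thesis by (simp add: torus_integral_henstock contD)
qed

end

section \<open>Mean values of trigonometric functions over the torus\<close>

lemma cos_periodic_shift: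
  fixes k x :: "real^'n"
  assumes "\<And>i. k $ i \<in> \<int>"
  shows "cos (2 * pi * (k \<bullet> (x + axis j 1)) + c) = cos (2 * pi * (k \<bullet> x) + c)"
    and "sin (2 * pi * (k \<bullet> (x + axis j 1)) + c) = sin (2 * pi * (k \<bullet> x) + c)"
proof -
  obtain n :: int where "k $ j = of_int n" using assms Ints_cases by blast
  then have "2 * pi * (k \<bullet> (x + axis j 1)) + c = (2 * pi * (k \<bullet> x) + c) + of_int n * (2 * pi)"
    by (simp add: inner_add_right inner_axis algebra_simps)
  then show "cos (2 * pi * (k \<bullet> (x + axis j 1)) + c) = cos (2 * pi * (k \<bullet> x) + c)"
    and "sin (2 * pi * (k \<bullet> (x + axis j 1)) + c) = sin (2 * pi * (k \<bullet> x) + c)"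
    by (simp_all add: cos_add sin_add mult.commute[of "of_int n"])
qed

text \<open>Shifting by half a period in the direction of \<open>k\<close> changes the sign of the cosine.\<close>
lemma torus_integral_cos:
  fixes k :: "real^'n"
  assumes k: "\<And>i. k $ i \<in> \<int>" and nz: "k \<noteq> 0"
  shows "(\<integral>x. cos (2 * pi * (k \<bullet> x)) \<partial>torus_unif) = 0"
proof -
  interpret periodic "\<lambda>x. cos (2 * pi * (k \<bullet> x))" 1
  proof
    show "cos (2 * pi * (k \<bullet> (x + axis j 1))) = cos (2 * pi * (k \<bullet> x))" for x j
      using cos_periodic_shift(1)[OF k, of x j 0] by simp
  qed auto
  have "2 * pi * (k \<bullet> (x + (1 / (2 * (k \<bullet> k))) *\<^sub>R k)) = 2 * pi * (k \<bullet> x) + pi" for x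
    using nz by (simp add: inner_add_right field_simps)
  then have "cos (2 * pi * (k \<bullet> (x + (1 / (2 * (k \<bullet> k))) *\<^sub>R k))) = - cos (2 * pi * (k \<bullet> x))" for x
    by simp
  then show ?thesis using integral_shift[of "(1 / (2 * (k \<bullet> k))) *\<^sub>R k"] by simp
qed

section \<open>Invariance of Lebesgue measure on finite products\<close>

interpretation lborel_PiM: product_sigma_finite "\<lambda>_. lborel :: real measure" ..

abbreviation lborel_fun :: "'a set \<Rightarrow> ('a \<Rightarrow> real) measure" where
  "lborel_fun V \<equiv> PiM V (\<lambda>_. lborel)"

text \<open>Testing against nonnegative functions allows invariance to be proved by Fubini and
  one-dimensional substitutions.\<close>

lemma distr_eqI_nn_integral:
  assumes R: "R \<in> M \<rightarrow>\<^sub>M M"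
    and eq: "\<And>f. f \<in> borel_measurable M \<Longrightarrow> (\<integral>\<^sup>+x. f (R x) \<partial>M) = (\<integral>\<^sup>+x. f x \<partial>M)"
  shows "distr M M R = M"
proof (rule measure_eqI)
  fix A assume "A \<in> sets (distr M M R)"
  then have A: "A \<in> sets M" by simp
  have "emeasure (distr M M R) A = (\<integral>\<^sup>+x. indicator A (R x) \<partial>M)"
    using A R by (subst nn_integral_indicator[symmetric], simp, subst nn_integral_distr) auto
  also have "\<dots> = emeasure M A" using A by (subst eq) auto
  finally show "emeasure (distr M M R) A = emeasure M A" .
qed simp

lemma lborel_fun_negate_invariant:
  assumes V: "finite V" "v \<in> V"
  shows "distr (lborel_fun V) (lborel_fun V) (\<lambda>y. y(v := - y v)) = lborel_fun V"
proof (rule distr_eqI_nn_integral)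
  define J where "J = V - {v}"
  have J: "V = insert v J" "v \<notin> J" "finite J" using V by (auto simp: J_def)
  show meas [measurable]: "(\<lambda>y. y(v := - y v)) \<in> lborel_fun V \<rightarrow>\<^sub>M lborel_fun V"
    using V by (intro measurable_fun_upd[where J = V]) auto
  fix f :: "_ \<Rightarrow> ennreal" assume f [measurable]: "f \<in> borel_measurable (lborel_fun V)"
  have "(\<integral>\<^sup>+y. f (y(v := - y v)) \<partial>lborel_fun V) = (\<integral>\<^sup>+x. \<integral>\<^sup>+t. f (x(v := - t)) \<partial>lborel \<partial>lborel_fun J)"
    using measurable_compose[OF meas f] J
    by (simp add: lborel_PiM.product_nn_integral_insert fun_upd_upd)
  also have "\<dots> = (\<integral>\<^sup>+x. \<integral>\<^sup>+t. f (x(v := t)) \<partial>lborel \<partial>lborel_fun J)"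
  proof (rule nn_integral_cong)
    fix x assume x: "x \<in> space (lborel_fun J)"
    have "(\<lambda>t. f (x(v := t))) \<in> borel_measurable lborel"
      using measurable_compose[OF measurable_component_update[OF x J(2)] f[unfolded J(1)]] .
    then show "(\<integral>\<^sup>+t. f (x(v := - t)) \<partial>lborel) = (\<integral>\<^sup>+t. f (x(v := t)) \<partial>lborel)"
      using nn_integral_real_affine[of "\<lambda>t. f (x(v := t))" "-1" 0] by simp
  qed
  also have "\<dots> = (\<integral>\<^sup>+y. f y \<partial>lborel_fun V)"
    using f J by (simp add: lborel_PiM.product_nn_integral_insert)
  finally show "(\<integral>\<^sup>+y. f (y(v := - y v)) \<partial>lborel_fun V) = (\<integral>\<^sup>+y. f y \<partial>lborel_fun V)" .
qed

text \<open>The planar map factors into two affine substitutions in one variable each, with Fubini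
  in between. The first produces the factor \<open>sqrt 2\<close>, the second absorbs it.\<close>

lemma nn_integral_lborel_reflect:
  fixes F :: "real \<Rightarrow> real \<Rightarrow> ennreal"
  assumes F [measurable]: "case_prod F \<in> borel_measurable (borel \<Otimes>\<^sub>M borel)"
  shows "(\<integral>\<^sup>+b. \<integral>\<^sup>+a. F ((a + b) / sqrt 2) ((a - b) / sqrt 2) \<partial>lborel \<partial>lborel)
       = (\<integral>\<^sup>+b. \<integral>\<^sup>+a. F a b \<partial>lborel \<partial>lborel)"
proof -
  have [measurable]: "(\<lambda>x. F (g x) (k x)) \<in> borel_measurable M"
    if "g \<in> borel_measurable M" "k \<in> borel_measurable M" for g k and M :: "'x measure"
    using measurable_compose[OF measurable_Pair[OF that] F] by simp
  have s: "(sqrt 2 * a - b - b) / sqrt 2 = a - sqrt 2 * b" for a b :: real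
    by (simp add: field_simps)
  have "(\<integral>\<^sup>+a. F ((a + b) / sqrt 2) ((a - b) / sqrt 2) \<partial>lborel)
      = sqrt 2 * (\<integral>\<^sup>+a. F a (a - sqrt 2 * b) \<partial>lborel)" for b
    using nn_integral_real_affine[of "\<lambda>a. F ((a + b) / sqrt 2) ((a - b) / sqrt 2)" "sqrt 2" "-b"] s[of _ b]
    by simp
  then have "(\<integral>\<^sup>+b. \<integral>\<^sup>+a. F ((a + b) / sqrt 2) ((a - b) / sqrt 2) \<partial>lborel \<partial>lborel)
      = sqrt 2 * (\<integral>\<^sup>+b. \<integral>\<^sup>+a. F a (a - sqrt 2 * b) \<partial>lborel \<partial>lborel)"
    by (simp add: nn_integral_cmult)
  also have "(\<integral>\<^sup>+b. \<integral>\<^sup>+a. F a (a - sqrt 2 * b) \<partial>lborel \<partial>lborel)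
      = (\<integral>\<^sup>+a. \<integral>\<^sup>+b. F a (a - sqrt 2 * b) \<partial>lborel \<partial>lborel)"
    by (rule lborel_pair.Fubini') measurable
  also have "sqrt 2 * \<dots> = (\<integral>\<^sup>+a. sqrt 2 * (\<integral>\<^sup>+b. F a (a - sqrt 2 * b) \<partial>lborel) \<partial>lborel)"
    by (rule nn_integral_cmult[symmetric]) measurable
  also have "\<dots> = (\<integral>\<^sup>+a. \<integral>\<^sup>+b. F a b \<partial>lborel \<partial>lborel)"
    using nn_integral_real_affine[of "F a" "- sqrt 2" a for a] by simp
  also have "\<dots> = (\<integral>\<^sup>+b. \<integral>\<^sup>+a. F a b \<partial>lborel \<partial>lborel)"
    by (rule lborel_pair.Fubini'[symmetric]) measurable
  finally show ?thesis .
qed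

text \<open>For \<open>v\<close> different from \<open>w\<close>, this acts on the two coordinates
  by the symmetric orthogonal matrix with rows (1, 1) and (1, -1) over \<open>sqrt 2\<close>. Unlike
  sign changes it mixes coordinates, and thereby relates different moments.\<close>

definition reflect :: "'a \<Rightarrow> 'a \<Rightarrow> ('a \<Rightarrow> real) \<Rightarrow> 'a \<Rightarrow> real" where
  "reflect v w y = y(w := (y v - y w) / sqrt 2, v := (y v + y w) / sqrt 2)"

lemma lborel_fun_reflect_invariant:
  assumes V: "finite V" "v \<in> V" "w \<in> V" "v \<noteq> w"
  shows "reflect v w \<in> lborel_fun V \<rightarrow>\<^sub>M lborel_fun V"
    and "distr (lborel_fun V) (lborel_fun V) (reflect v w) = lborel_fun V"
proof -
  show meas [measurable]: "reflect v w \<in> lborel_fun V \<rightarrow>\<^sub>M lborel_fun V"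
    unfolding reflect_def using V
    by (intro measurable_fun_upd[where J = V]) auto
  define J where "J = V - {v, w}"
  have J: "V = insert v (insert w J)" "v \<notin> insert w J" "w \<notin> J" "finite J"
    using V by (auto simp: J_def)
  show "distr (lborel_fun V) (lborel_fun V) (reflect v w) = lborel_fun V"
  proof (rule distr_eqI_nn_integral[OF meas])
    fix f :: "_ \<Rightarrow> ennreal" assume f [measurable]: "f \<in> borel_measurable (lborel_fun V)"
    \<comment> \<open>Two coordinates are split off one after the other; the second splitting
      requires measurability of the inner integral in the remaining coordinates.\<close>
    have expand: "(\<integral>\<^sup>+y. g y \<partial>lborel_fun V)
        = (\<integral>\<^sup>+x. \<integral>\<^sup>+b. \<integral>\<^sup>+a. g (x(w := b, v := a)) \<partial>lborel \<partial>lborel \<partial>lborel_fun J)"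
      if g: "g \<in> borel_measurable (lborel_fun V)" for g :: "_ \<Rightarrow> ennreal"
    proof -
      have g': "g \<in> borel_measurable (lborel_fun (insert v (insert w J)))" using g J(1) by simp
      have "(\<lambda>(x, a). g (x(v := a))) \<in> borel_measurable (lborel_fun (insert w J) \<Otimes>\<^sub>M lborel)"
        using measurable_compose[OF measurable_add_dim g'] by (simp add: split_beta)
      then have "(\<lambda>x. \<integral>\<^sup>+a. g (x(v := a)) \<partial>lborel) \<in> borel_measurable (lborel_fun (insert w J))"
        by (rule lborel.borel_measurable_nn_integral)
      then show ?thesis
        using J by (simp add: lborel_PiM.product_nn_integral_insert g'
            lborel_PiM.product_nn_integral_insert[OF J(4,3)])
    qed
    have "(\<integral>\<^sup>+y. f (reflect v w y) \<partial>lborel_fun V)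
        = (\<integral>\<^sup>+x. \<integral>\<^sup>+b. \<integral>\<^sup>+a. f (reflect v w (x(w := b, v := a))) \<partial>lborel \<partial>lborel \<partial>lborel_fun J)"
      by (rule expand[OF measurable_compose[OF meas f]])
    also have "\<dots> = (\<integral>\<^sup>+x. \<integral>\<^sup>+b. \<integral>\<^sup>+a. f (x(w := b, v := a)) \<partial>lborel \<partial>lborel \<partial>lborel_fun J)"
    proof (rule nn_integral_cong)
      fix x assume x: "x \<in> space (lborel_fun J)"
      have upd: "(\<lambda>p. x(w := snd p, v := fst p)) \<in> borel \<Otimes>\<^sub>M borel \<rightarrow>\<^sub>M lborel_fun V"
        using x J
        by (intro measurable_fun_upd[where J = "insert w J"] measurable_fun_upd[where J = J]) auto
      have "(\<integral>\<^sup>+b. \<integral>\<^sup>+a. f (x(w := (a - b) / sqrt 2, v := (a + b) / sqrt 2)) \<partial>lborel \<partial>lborel)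
          = (\<integral>\<^sup>+b. \<integral>\<^sup>+a. f (x(w := b, v := a)) \<partial>lborel \<partial>lborel)"
        using nn_integral_lborel_reflect[of "\<lambda>a b. f (x(w := b, v := a))"] measurable_compose[OF upd f]
        by (simp add: split_beta)
      moreover have "reflect v w (x(w := b, v := a)) = x(w := (a - b) / sqrt 2, v := (a + b) / sqrt 2)" for a b
        using V(4) by (auto simp: reflect_def fun_eq_iff)
      ultimately show "(\<integral>\<^sup>+b. \<integral>\<^sup>+a. f (reflect v w (x(w := b, v := a))) \<partial>lborel \<partial>lborel)
          = (\<integral>\<^sup>+b. \<integral>\<^sup>+a. f (x(w := b, v := a)) \<partial>lborel \<partial>lborel)" by simp
    qed
    also have "\<dots> = (\<integral>\<^sup>+y. f y \<partial>lborel_fun V)" by (rule expand[OF f, symmetric])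
    finally show "(\<integral>\<^sup>+y. f (reflect v w y) \<partial>lborel_fun V) = (\<integral>\<^sup>+y. f y \<partial>lborel_fun V)" .
  qed
qed

section \<open>Moments of the uniform distribution on a sphere\<close>

lemma sets_lborel_fun: "sets (lborel_fun V) = sets (PiM V (\<lambda>_. borel :: real measure))"
  by (intro sets_PiM_cong) auto

lemma emeasure_unit_ball_fun:
  assumes "finite V"
  shows "emeasure (lborel_fun V) {y \<in> space (lborel_fun V). (\<Sum>v\<in>V. (y v)\<^sup>2) \<le> 1}
    = ennreal (unit_ball_vol (real (card V)))"
proof -
  have "{y \<in> space (lborel_fun V). (\<Sum>v\<in>V. (y v)\<^sup>2) \<le> 1}
      = {y. sqrt (\<Sum>v\<in>V. (y v)\<^sup>2) \<le> 1} \<inter> space (lborel_fun V)" by auto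
  then show ?thesis using emeasure_cball_aux[OF assms, of 1] by simp
qed

locale finite_sphere =
  fixes V :: "'a set" and r :: real
  assumes finV: "finite V" and neV: "V \<noteq> {}"
begin

abbreviation S :: "('a \<Rightarrow> real) measure" where "S \<equiv> sphere_unif V r"

definition ball :: "('a \<Rightarrow> real) set" where
  "ball = {y \<in> space (lborel_fun V). (\<Sum>v\<in>V. (y v)\<^sup>2) \<le> 1}"

text \<open>At the origin, division by zero yields the zero function, which is off the sphere if
  \<open>r\<close> is nonzero; the norm identity is therefore an almost-everywhere
  statement.\<close>

definition proj :: "('a \<Rightarrow> real) \<Rightarrow> 'a \<Rightarrow> real" where
  "proj y = restrict (\<lambda>v. r / sqrt (\<Sum>u\<in>V. (y u)\<^sup>2) * y v) V"

lemma S_eq: "S = distr (uniform_measure (lborel_fun V) ball) (PiM V (\<lambda>_. borel)) proj"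
  unfolding sphere_unif_def ball_def proj_def[abs_def] ..

lemma measurable_component [measurable (raw)]:
  assumes "v \<in> V" shows "(\<lambda>y. y v) \<in> borel_measurable (lborel_fun V)"
  using measurable_component_singleton[OF assms, of "\<lambda>_. lborel :: real measure"] by simp

lemma measurable_sum_squares [measurable]: "(\<lambda>y. \<Sum>v\<in>V. (y v)\<^sup>2) \<in> borel_measurable (lborel_fun V)"
  by (intro borel_measurable_sum borel_measurable_power measurable_component)

lemma ball_measurable [measurable]: "ball \<in> sets (lborel_fun V)"
  unfolding ball_def by measurable

lemma measurable_proj [measurable]: "proj \<in> lborel_fun V \<rightarrow>\<^sub>M PiM V (\<lambda>_. borel)"
  unfolding proj_def by (intro measurable_restrict borel_measurable_times borel_measurable_divide
      borel_measurable_sqrt measurable_sum_squares measurable_component borel_measurable_const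
      measurable_compose[OF measurable_sum_squares]) auto

lemma sets_S: "sets S = sets (PiM V (\<lambda>_. borel))"
  by (simp add: S_eq)

lemma emeasure_ball: "emeasure (lborel_fun V) ball = ennreal (unit_ball_vol (real (card V)))"
  unfolding ball_def by (rule emeasure_unit_ball_fun[OF finV])

lemma prob_space_S: "prob_space S"
proof -
  interpret prob_space "uniform_measure (lborel_fun V) ball"
    using unit_ball_vol_pos[of "real (card V)", OF of_nat_0_le_iff]
    by (intro prob_space_uniform_measure) (auto simp: emeasure_ball simp del: unit_ball_vol_pos)
  show ?thesis unfolding S_eq by (rule prob_space_distr) measurable
qed

text \<open>Sphere averages become Lebesgue integrals over the ball, so that symmetries of Lebesgue
  measure carry over.\<close>

lemma integral_S:
  fixes \<phi> :: "('a \<Rightarrow> real) \<Rightarrow> real"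
  assumes [measurable]: "\<phi> \<in> borel_measurable (PiM V (\<lambda>_. borel))"
  shows "(\<integral>a. \<phi> a \<partial>S) = (\<integral>y. indicator ball y / unit_ball_vol (real (card V)) * \<phi> (proj y) \<partial>lborel_fun V)"
proof -
  have pos: "unit_ball_vol (real (card V)) > 0" by (rule unit_ball_vol_pos) simp
  have "uniform_measure (lborel_fun V) ball
      = density (lborel_fun V) (\<lambda>y. ennreal (indicator ball y / unit_ball_vol (real (card V))))"
    unfolding uniform_measure_def emeasure_ball
    by (simp add: ennreal_indicator[symmetric] divide_ennreal pos)
  then show ?thesis
    unfolding S_eq by (subst integral_distr, simp, simp, simp, subst integral_density)
      (use pos in \<open>auto simp: unit_ball_vol_nonneg\<close>)
qed

text \<open>Preserving the norm keeps the ball, and together with homogeneity makes \<open>R\<close>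
  commute with \<open>proj\<close>; what remains is the invariance of Lebesgue measure.\<close>

lemma integral_S_invariant:
  fixes \<phi> :: "('a \<Rightarrow> real) \<Rightarrow> real"
  assumes [measurable]: "R \<in> lborel_fun V \<rightarrow>\<^sub>M lborel_fun V"
    and inv: "distr (lborel_fun V) (lborel_fun V) R = lborel_fun V"
    and norm: "\<And>y. (\<Sum>v\<in>V. (R y v)\<^sup>2) = (\<Sum>v\<in>V. (y v)\<^sup>2)"
    and scale: "\<And>y c. y \<in> space (lborel_fun V) \<Longrightarrow>
      R (restrict (\<lambda>v. c * y v) V) = restrict (\<lambda>v. c * R y v) V"
    and \<phi> [measurable]: "\<phi> \<in> borel_measurable (PiM V (\<lambda>_. borel))"
  shows "(\<integral>a. \<phi> (R a) \<partial>S) = (\<integral>a. \<phi> a \<partial>S)"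
proof -
  have sp: "R y \<in> space (lborel_fun V)" if "y \<in> space (lborel_fun V)" for y
    using assms(1) that by (rule measurable_space)
  have R': "R \<in> PiM V (\<lambda>_. borel) \<rightarrow>\<^sub>M PiM V (\<lambda>_. borel)"
    using assms(1) by (simp add: sets_lborel_fun cong: measurable_cong_sets)
  let ?g = "\<lambda>y. indicator ball y / unit_ball_vol (real (card V)) * \<phi> (proj y)"
  have "(\<integral>a. \<phi> (R a) \<partial>S)
      = (\<integral>y. indicator ball y / unit_ball_vol (real (card V)) * \<phi> (R (proj y)) \<partial>lborel_fun V)"
    by (rule integral_S[OF measurable_compose[OF R' \<phi>]])
  also have "\<dots> = (\<integral>y. ?g (R y) \<partial>lborel_fun V)"
  proof (rule Bochner_Integration.integral_cong[OF refl])
    fix y assume y: "y \<in> space (lborel_fun V)"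
    have "indicator ball y = (indicator ball (R y) :: real)"
      using y sp[OF y] by (simp add: indicator_def ball_def norm)
    moreover have "R (proj y) = proj (R y)"
      unfolding proj_def norm by (rule scale[OF y])
    ultimately show "indicator ball y / unit_ball_vol (real (card V)) * \<phi> (R (proj y)) = ?g (R y)" by simp
  qed
  also have "\<dots> = (\<integral>y. ?g y \<partial>distr (lborel_fun V) (lborel_fun V) R)"
    by (rule integral_distr[symmetric]) measurable
  also have "\<dots> = (\<integral>a. \<phi> a \<partial>S)" unfolding inv by (rule integral_S[OF \<phi>, symmetric])
  finally show ?thesis .
qed

lemma integral_S_negate:
  fixes \<phi> :: "('a \<Rightarrow> real) \<Rightarrow> real"
  assumes v: "v \<in> V" and \<phi>: "\<phi> \<in> borel_measurable (PiM V (\<lambda>_. borel))"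
  shows "(\<integral>a. \<phi> (a(v := - a v)) \<partial>S) = (\<integral>a. \<phi> a \<partial>S)"
proof (rule integral_S_invariant[OF _ lborel_fun_negate_invariant[OF finV v] _ _ \<phi>])
  show "(\<lambda>y. y(v := - y v)) \<in> lborel_fun V \<rightarrow>\<^sub>M lborel_fun V"
    using v by (intro measurable_fun_upd[where J = V]) auto
  show "(\<Sum>u\<in>V. ((y(v := - y v)) u)\<^sup>2) = (\<Sum>u\<in>V. (y u)\<^sup>2)" for y :: "'a \<Rightarrow> real"
    by (intro sum.cong) auto
qed (use v in \<open>auto simp: fun_eq_iff restrict_def\<close>)

lemma integral_S_reflect:
  fixes \<phi> :: "('a \<Rightarrow> real) \<Rightarrow> real"
  assumes vw: "v \<in> V" "w \<in> V" "v \<noteq> w" and \<phi>: "\<phi> \<in> borel_measurable (PiM V (\<lambda>_. borel))"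
  shows "(\<integral>a. \<phi> (reflect v w a) \<partial>S) = (\<integral>a. \<phi> a \<partial>S)"
proof (rule integral_S_invariant[OF lborel_fun_reflect_invariant[OF finV vw] _ _ \<phi>])
  show "(\<Sum>u\<in>V. (reflect v w y u)\<^sup>2) = (\<Sum>u\<in>V. (y u)\<^sup>2)" for y
  proof -
    have split: "(\<Sum>u\<in>V. f u) = f v + f w + (\<Sum>u\<in>V - {v, w}. f u)" for f :: "'a \<Rightarrow> real"
      using finV vw by (subst sum.subset_diff[of "{v, w}" V]) auto
    have "(\<Sum>u\<in>V - {v, w}. (reflect v w y u)\<^sup>2) = (\<Sum>u\<in>V - {v, w}. (y u)\<^sup>2)"
      by (intro sum.cong) (auto simp: reflect_def)
    then show ?thesis
      using vw(3) by (simp add: split reflect_def power_divide power2_sum power2_diff field_simps)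
  qed
qed (use vw in \<open>auto simp: fun_eq_iff restrict_def reflect_def field_simps\<close>)

text \<open>Radial projection has the right norm away from the origin, and the origin is a null set
  because \<open>V\<close> is nonempty.\<close>

lemma AE_S_norm: "AE a in S. (\<Sum>v\<in>V. (a v)\<^sup>2) = r\<^sup>2"
proof -
  have "(\<Sum>v\<in>V. (proj y v)\<^sup>2) = r\<^sup>2" if "(\<Sum>v\<in>V. (y v)\<^sup>2) \<noteq> 0" for y
  proof -
    have "(\<Sum>v\<in>V. (proj y v)\<^sup>2) = (r / sqrt (\<Sum>u\<in>V. (y u)\<^sup>2))\<^sup>2 * (\<Sum>v\<in>V. (y v)\<^sup>2)"
      unfolding sum_distrib_left by (intro sum.cong) (auto simp: proj_def power_mult_distrib power_divide)
    then show ?thesis using that by (simp add: power_divide sum_nonneg)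
  qed
  moreover have "AE y in lborel_fun V. (\<Sum>v\<in>V. (y v)\<^sup>2) \<noteq> 0"
  proof -
    have "emeasure (lborel_fun V) (PiE V (\<lambda>_. {0})) = (\<Prod>v\<in>V. emeasure lborel {0::real})"
      by (rule lborel_PiM.emeasure_PiM[OF finV]) simp
    also have "\<dots> = 0" using finV neV by (simp add: card_gt_0_iff)
    finally have "AE y in lborel_fun V. y \<notin> PiE V (\<lambda>_. {0})"
      by (intro AE_not_in null_setsI sets_PiM_I_finite finV) auto
    then show ?thesis
    proof (rule AE_mp, intro AE_I2 impI)
      fix y assume "y \<in> space (lborel_fun V)" "y \<notin> PiE V (\<lambda>_. {0})"
      then have "\<exists>v\<in>V. y v \<noteq> 0" unfolding PiE_iff space_PiM by blast
      then show "(\<Sum>v\<in>V. (y v)\<^sup>2) \<noteq> 0" using finV by (auto simp: sum_nonneg_eq_0_iff)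
    qed
  qed
  ultimately have "AE y in lborel_fun V. (\<Sum>v\<in>V. (proj y v)\<^sup>2) = r\<^sup>2" by auto
  then have "AE y in uniform_measure (lborel_fun V) ball. (\<Sum>v\<in>V. (proj y v)\<^sup>2) = r\<^sup>2"
    unfolding uniform_measure_def by (subst AE_density) auto
  then show ?thesis unfolding S_eq
    by (subst AE_distr_iff) (auto intro!: measurable_compose[OF _ measurable_ident] borel_measurable_sum)
qed

lemma measurable_S_component [measurable (raw)]:
  assumes "v \<in> V" shows "(\<lambda>a. a v) \<in> borel_measurable (PiM V (\<lambda>_. borel))"
  using measurable_component_singleton[OF assms, of "\<lambda>_. borel"] .

lemma AE_S_bound: "AE a in S. \<forall>v\<in>V. \<bar>a v\<bar> \<le> \<bar>r\<bar>"
  using AE_S_norm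
proof eventually_elim
  case (elim a)
  show ?case
  proof
    fix v assume "v \<in> V"
    then have "(a v)\<^sup>2 \<le> r\<^sup>2" using finV elim member_le_sum[of v V "\<lambda>v. (a v)\<^sup>2"] by simp
    then show "\<bar>a v\<bar> \<le> \<bar>r\<bar>" by (rule abs_le_square_iff[THEN iffD2])
  qed
qed

section \<open>Moments of order two and four\<close>

lemma integrable_S_prod4:
  assumes "v \<in> V" "w \<in> V" "x \<in> V" "y \<in> V"
  shows "integrable S (\<lambda>a. a v * a w * a x * a y)"
proof -
  interpret prob_space S by (rule prob_space_S)
  show ?thesis
  proof (rule integrable_const_bound[where B = "\<bar>r\<bar> * \<bar>r\<bar> * \<bar>r\<bar> * \<bar>r\<bar>"])
    show "AE a in S. norm (a v * a w * a x * a y) \<le> \<bar>r\<bar> * \<bar>r\<bar> * \<bar>r\<bar> * \<bar>r\<bar>"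
      using AE_S_bound unfolding real_norm_def abs_mult
      by eventually_elim (intro mult_mono; use assms in simp)
  qed (use assms sets_S in \<open>simp cong: measurable_cong_sets\<close>)
qed

lemma integrable_S_prod2:
  assumes "v \<in> V" "w \<in> V"
  shows "integrable S (\<lambda>a. a v * a w)"
proof -
  interpret prob_space S by (rule prob_space_S)
  show ?thesis
  proof (rule integrable_const_bound[where B = "\<bar>r\<bar> * \<bar>r\<bar>"])
    show "AE a in S. norm (a v * a w) \<le> \<bar>r\<bar> * \<bar>r\<bar>"
      using AE_S_bound unfolding real_norm_def abs_mult
      by eventually_elim (intro mult_mono; use assms in simp)
  qed (use assms sets_S in \<open>simp cong: measurable_cong_sets\<close>)
qed

lemma integral_S_odd:
  fixes \<phi> :: "('a \<Rightarrow> real) \<Rightarrow> real"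
  assumes "v \<in> V" "\<phi> \<in> borel_measurable (PiM V (\<lambda>_. borel))"
    and "\<And>a. \<phi> (a(v := - a v)) = - \<phi> a"
  shows "(\<integral>a. \<phi> a \<partial>S) = 0"
  using integral_S_negate[OF assms(1,2)] by (simp add: assms(3))

text \<open>The square of a reflected coordinate is the mean of the two squares plus a mixed term,
  which is odd and integrates to 0.\<close>

lemma moment2_eq:
  assumes vw: "v \<in> V" "w \<in> V"
  shows "(\<integral>a. a v * a v \<partial>S) = (\<integral>a. a w * a w \<partial>S)"
proof (cases "v = w")
  case False
  have odd: "(\<integral>a. a v * a w \<partial>S) = 0"
    by (rule integral_S_odd[of v]) (use vw False in auto)
  have "(\<integral>a. a v * a v \<partial>S) = (\<integral>a. reflect v w a v * reflect v w a v \<partial>S)"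
    by (rule integral_S_reflect[OF vw False, symmetric]) (use vw in measurable)
  also have "\<dots> = (\<integral>a. (a v * a v + a w * a w) / 2 + a v * a w \<partial>S)"
    by (intro Bochner_Integration.integral_cong) (auto simp: reflect_def field_simps)
  also have "\<dots> = ((\<integral>a. a v * a v \<partial>S) + (\<integral>a. a w * a w \<partial>S)) / 2"
    using vw by (simp add: integrable_S_prod2 odd)
  finally show ?thesis by simp
qed simp

lemma moment2:
  assumes v: "v \<in> V"
  shows "(\<integral>a. a v * a v \<partial>S) = r\<^sup>2 / card V"
proof -
  interpret prob_space S by (rule prob_space_S)
  have "(\<integral>a. (\<Sum>w\<in>V. a w * a w) \<partial>S) = (\<integral>a. r\<^sup>2 \<partial>S)"
    using AE_S_norm sets_S
    by (intro integral_cong_AE) (auto simp: power2_eq_square cong: measurable_cong_sets)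
  also have "(\<integral>a. (\<Sum>w\<in>V. a w * a w) \<partial>S) = (\<Sum>w\<in>V. \<integral>a. a w * a w \<partial>S)"
    by (intro Bochner_Integration.integral_sum integrable_S_prod2)
  also have "\<dots> = card V * (\<integral>a. a v * a v \<partial>S)"
    using moment2_eq[OF _ v] by simp
  finally show ?thesis using finV neV by (simp add: prob_space field_simps)
qed

text \<open>The reflection exchanges \<open>a v\<close> and \<open>(a v + a w) / sqrt 2\<close>, whose fourth power expands into
  the fourth moments and six times the mixed one.\<close>
lemma moment4_pair:
  assumes vw: "v \<in> V" "w \<in> V" "v \<noteq> w"
  shows "(\<integral>a. a v * a v * a v * a v \<partial>S) = 3 * (\<integral>a. a v * a v * a w * a w \<partial>S)"
    and "(\<integral>a. a w * a w * a w * a w \<partial>S) = (\<integral>a. a v * a v * a v * a v \<partial>S)"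
proof -
  let ?p = "\<lambda>v. \<integral>a. a v * a v * a v * a v \<partial>S" and ?q = "\<integral>a. a v * a v * a w * a w \<partial>S"
  have odd: "(\<integral>a. a v * a v * a v * a w \<partial>S) = 0" "(\<integral>a. a v * a w * a w * a w \<partial>S) = 0"
    by (rule integral_S_odd[of v]; use vw in auto)+
  have sq: "sqrt 2 * sqrt 2 * sqrt 2 * sqrt 2 = (4::real)" by simp
  have "?p u = (?p v + ?p w + 6 * ?q) / 4" if u: "u \<in> {v, w}" for u
  proof -
    \<comment> \<open>The sign treats both reflected coordinates, sum and difference, at
      once.\<close>
    define s :: real where "s = (if u = v then 1 else -1)"
    have s: "s * s = 1" by (simp add: s_def)
    have "?p u = (\<integral>a. reflect v w a u * reflect v w a u * reflect v w a u * reflect v w a u \<partial>S)"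
      by (rule integral_S_reflect[OF vw, symmetric]) (use vw u in \<open>auto\<close>)
    also have "\<dots> = (\<integral>a. (a v * a v * a v * a v + a w * a w * a w * a w) / 4
        + (3 / 2) * (a v * a v * a w * a w) + s * (a v * a v * a v * a w) + s * (a v * a w * a w * a w) \<partial>S)"
    proof (intro Bochner_Integration.integral_cong refl)
      fix a :: "'a \<Rightarrow> real"
      have "reflect v w a u = (a v + s * a w) / sqrt 2" using u vw by (auto simp: reflect_def s_def)
      then have "reflect v w a u * reflect v w a u * reflect v w a u * reflect v w a u
          = (a v + s * a w) * (a v + s * a w) * (a v + s * a w) * (a v + s * a w) / 4"
        by (simp add: sq)
      also have "\<dots> = (a v * a v * a v * a v + a w * a w * a w * a w) / 4
        + (3 / 2) * (a v * a v * a w * a w) + s * (a v * a v * a v * a w) + s * (a v * a w * a w * a w)"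
        unfolding s_def by (auto simp: field_simps)
      finally show "reflect v w a u * reflect v w a u * reflect v w a u * reflect v w a u = \<dots>" .
    qed
    also have "\<dots> = (?p v + ?p w + 6 * ?q) / 4"
      using vw by (simp add: integrable_S_prod4 odd)
    finally show ?thesis .
  qed
  \<comment> \<open>The right-hand side is the same for \<open>v\<close> and \<open>w\<close>, so
    the two fourth moments agree; then \<open>4 * p = 2 * p + 6 * q\<close> gives
    \<open>p = 3 * q\<close>.\<close>
  from this[of v] this[of w] show "?p v = 3 * ?q" "?p w = ?p v" by simp_all
qed

text \<open>All mixed moments equal a third of the pure one. Expanding the squared sum of squares,
  which is \<open>r ^ 4\<close>, gives \<open>card V\<close> terms of weight 3 and
  \<open>card V * (card V - 1)\<close> of weight 1, hence the factor
  \<open>card V * (card V + 2)\<close>.\<close>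

lemma moment4_eq:
  assumes "v \<in> V" "w \<in> V"
  shows "(\<integral>a. a v * a v * a w * a w \<partial>S)
    = (if v = w then 3 else 1) * (r ^ 4 / (card V * (card V + 2)))"
proof -
  interpret prob_space S by (rule prob_space_S)
  define p where "p = (\<integral>a. a v * a v * a v * a v \<partial>S)"
  have p: "(\<integral>a. a u * a u * a u * a u \<partial>S) = p" if "u \<in> V" for u
    using moment4_pair(2)[of v u] that assms by (cases "u = v") (auto simp: p_def)
  have q: "(\<integral>a. a u * a u * a x * a x \<partial>S) = (if u = x then 3 else 1) * (p / 3)" if "u \<in> V" "x \<in> V" for u x
    using moment4_pair(1)[of u x] p that by (cases "u = x") auto
  have "(\<integral>a. (\<Sum>u\<in>V. \<Sum>x\<in>V. a u * a u * a x * a x) \<partial>S) = (\<integral>a. r ^ 4 \<partial>S)"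
  proof (rule integral_cong_AE)
    show "AE a in S. (\<Sum>u\<in>V. \<Sum>x\<in>V. a u * a u * a x * a x) = r ^ 4"
      using AE_S_norm
    proof eventually_elim
      case (elim a)
      have "(\<Sum>u\<in>V. \<Sum>x\<in>V. a u * a u * a x * a x) = (\<Sum>u\<in>V. (a u)\<^sup>2) * (\<Sum>x\<in>V. (a x)\<^sup>2)"
        unfolding sum_product by (simp add: power2_eq_square algebra_simps)
      then show ?case by (simp add: elim power_add[symmetric])
    qed
  qed (use sets_S in \<open>auto cong: measurable_cong_sets\<close>)
  also have "(\<integral>a. (\<Sum>u\<in>V. \<Sum>x\<in>V. a u * a u * a x * a x) \<partial>S)
      = (\<Sum>u\<in>V. \<Sum>x\<in>V. \<integral>a. a u * a u * a x * a x \<partial>S)"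
    by (subst Bochner_Integration.integral_sum)
      (auto intro!: sum.cong Bochner_Integration.integral_sum integrable_S_prod4 Bochner_Integration.integrable_sum)
  also have "\<dots> = (\<Sum>u\<in>V. \<Sum>x\<in>V. p / 3 + (if u = x then 2 * (p / 3) else 0))"
    by (intro sum.cong) (auto simp: q)
  also have "\<dots> = card V * (card V + 2) * (p / 3)"
    using finV by (simp add: sum.distrib algebra_simps)
  finally have "card V * (card V + 2) * (p / 3) = r ^ 4" by (simp add: prob_space)
  moreover have "real (card V) * (card V + 2) \<noteq> 0" using finV neV by auto
  ultimately have "p / 3 = r ^ 4 / (card V * (card V + 2))" by (simp add: field_simps)
  then show ?thesis using q[OF assms] by (simp only:)
qed

text \<open>The spherical analogue of the Wick formula: one term for each pairing of the four
  indices. When all indices coincide, all three pairings count, which is the factor 3.\<close>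

lemma moment4:
  assumes V: "v \<in> V" "w \<in> V" "x \<in> V" "y \<in> V"
  shows "(\<integral>a. a v * a w * a x * a y \<partial>S) = r ^ 4 / (card V * (card V + 2))
    * (of_bool (v = w \<and> x = y) + of_bool (v = x \<and> w = y) + of_bool (v = y \<and> w = x))"
proof -
  have odd: "(\<integral>a. a v * a w * a x * a y \<partial>S) = 0"
    if "u \<in> V" "\<And>a::'a \<Rightarrow> real. let b = a(u := - a u) in b v * b w * b x * b y = - (a v * a w * a x * a y)" for u
    by (rule integral_S_odd[of u]) (use that V in \<open>auto simp: Let_def\<close>)
  \<comment> \<open>Either the indices match in pairs, or some index occurs exactly once and the
    product is odd in it.\<close>
  consider "v = w" "x = y" | "v = x" "w = y" | "v = y" "w = x"
    | "v \<notin> {w, x, y}" | "w \<notin> {v, x, y}" | "x \<notin> {v, w, y}" | "y \<notin> {v, w, x}" by blast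
  then show ?thesis
  proof cases
    case 1 then show ?thesis using moment4_eq[OF V(1,3)] by auto
  next
    case 2 then show ?thesis using moment4_eq[OF V(1,2)] by (auto simp: mult.commute mult.left_commute)
  next
    case 3 then show ?thesis using moment4_eq[OF V(1,2)] by (auto simp: mult.commute mult.left_commute)
  next
    case 4 then show ?thesis using odd[OF V(1)] by auto
  next
    case 5 then show ?thesis using odd[OF V(2)] by auto
  next
    case 6 then show ?thesis using odd[OF V(3)] by auto
  next
    case 7 then show ?thesis using odd[OF V(4)] by auto
  qed
qed

end

section \<open>Random waves\<close>

text \<open>Jensen's inequality for the square root, obtained from the nonnegativity of the variance
  of \<open>sqrt (W x)\<close>.\<close>

lemma (in prob_space) expectation_sqrt_le:
  fixes W :: "'a \<Rightarrow> real"
  assumes int: "integrable M W" and nonneg: "\<And>x. 0 \<le> W x"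
  shows "integrable M (\<lambda>x. sqrt (W x))" "expectation (\<lambda>x. sqrt (W x)) \<le> sqrt (expectation W)"
proof -
  have le: "sqrt t \<le> 1 + t" if "0 \<le> t" for t :: real
    using that by (intro real_le_lsqrt) (auto simp: power2_eq_square algebra_simps)
  show sq: "integrable M (\<lambda>x. sqrt (W x))"
    by (rule Bochner_Integration.integrable_bound[of _ "\<lambda>x. 1 + W x"])
      (use int in \<open>auto simp: nonneg le intro!: borel_measurable_integrable\<close>)
  have "0 \<le> variance (\<lambda>x. sqrt (W x))" by (rule variance_positive)
  also have "\<dots> = expectation W - (expectation (\<lambda>x. sqrt (W x)))\<^sup>2"
    using int sq by (subst variance_eq) (auto simp: nonneg)
  finally show "expectation (\<lambda>x. sqrt (W x)) \<le> sqrt (expectation W)"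
    by (intro real_le_rsqrt) simp
qed

lemma torus_integrable_continuous:
  fixes F :: "real^'n \<Rightarrow> real"
  assumes "continuous_on UNIV F"
  shows "integrable torus_unif F"
proof -
  have [measurable]: "F \<in> borel_measurable borel" by (rule borel_measurable_continuous_onI[OF assms])
  have "integrable lborel (\<lambda>x. indicator (cbox 0 1) x *\<^sub>R F x)"
    by (rule borel_integrable_compact) (auto intro: continuous_on_subset[OF assms])
  then show ?thesis unfolding torus_unif_eq_density by (subst integrable_density) auto
qed

text \<open>In the product-to-sum formula the frequency \<open>k + l\<close> averages to 0, and
  \<open>k - l\<close> contributes only when it vanishes.\<close>

lemma torus_integral_cos_cos:
  fixes k l :: "real^'n"
  assumes k: "\<And>i. k $ i \<in> \<int>" and l: "\<And>i. l $ i \<in> \<int>" and nz: "k + l \<noteq> 0"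
  shows "(\<integral>x. cos (2 * pi * (k \<bullet> x)) * cos (2 * pi * (l \<bullet> x)) \<partial>torus_unif) = of_bool (k = l) / 2"
proof -
  interpret prob_space "torus_unif :: (real^'n) measure" by (rule prob_space_torus_unif)
  have cont: "continuous_on UNIV (\<lambda>x. cos (2 * pi * (m \<bullet> x)))" for m :: "real^'n"
    by (intro continuous_intros)
  have "(\<integral>x. cos (2 * pi * (k \<bullet> x)) * cos (2 * pi * (l \<bullet> x)) \<partial>torus_unif)
      = (\<integral>x. (cos (2 * pi * ((k - l) \<bullet> x)) + cos (2 * pi * ((k + l) \<bullet> x))) / 2 \<partial>torus_unif)"
    by (intro Bochner_Integration.integral_cong refl)
      (simp add: cos_times_cos inner_diff_left inner_add_left algebra_simps)
  also have "\<dots> = ((\<integral>x. cos (2 * pi * ((k - l) \<bullet> x)) \<partial>torus_unif)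
      + (\<integral>x. cos (2 * pi * ((k + l) \<bullet> x)) \<partial>torus_unif)) / 2"
    by (simp add: torus_integrable_continuous[OF cont])
  also have "(\<integral>x. cos (2 * pi * ((k + l) \<bullet> x)) \<partial>torus_unif) = 0"
    by (rule torus_integral_cos) (use k l nz in auto)
  also have "(\<integral>x. cos (2 * pi * ((k - l) \<bullet> x)) \<partial>torus_unif) = of_bool (k = l)"
  proof (cases "k = l")
    case False
    then show ?thesis using torus_integral_cos[of "k - l"] k l by simp
  qed simp
  finally show ?thesis by simp
qed

text \<open>Evaluates fourfold sums against the pairings of \<open>moment4\<close>; each pairing
  collapses two of the four sums.\<close>

lemma sum_pairings:
  fixes t :: "'a \<Rightarrow> 'a \<Rightarrow> 'a \<Rightarrow> 'a \<Rightarrow> real"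
  assumes "finite V"
  shows "(\<Sum>v\<in>V. \<Sum>w\<in>V. \<Sum>x\<in>V. \<Sum>y\<in>V. t v w x y *
      (of_bool (v = w \<and> x = y) + of_bool (v = x \<and> w = y) + of_bool (v = y \<and> w = x)))
    = (\<Sum>v\<in>V. \<Sum>x\<in>V. t v v x x) + (\<Sum>v\<in>V. \<Sum>w\<in>V. t v w v w) + (\<Sum>v\<in>V. \<Sum>w\<in>V. t v w w v)"
proof -
  have delta: "(\<Sum>y\<in>V. f y * of_bool (x = y)) = f x" "(\<Sum>y\<in>V. f y * of_bool (y = x)) = f x"
    if "x \<in> V" for f :: "'a \<Rightarrow> real" and x
    using that assms by (auto simp: of_bool_def if_distrib cong: if_cong)
  have 1: "(\<Sum>v\<in>V. \<Sum>w\<in>V. \<Sum>x\<in>V. \<Sum>y\<in>V. t v w x y * of_bool (v = w \<and> x = y)) = (\<Sum>v\<in>V. \<Sum>x\<in>V. t v v x x)"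
    by (simp add: of_bool_conj delta flip: mult.assoc sum_distrib_right cong: sum.cong)
  have 2: "(\<Sum>v\<in>V. \<Sum>w\<in>V. \<Sum>x\<in>V. \<Sum>y\<in>V. t v w x y * of_bool (v = x \<and> w = y)) = (\<Sum>v\<in>V. \<Sum>w\<in>V. t v w v w)"
    by (simp add: of_bool_conj delta flip: mult.assoc cong: sum.cong)
  have 3: "(\<Sum>v\<in>V. \<Sum>w\<in>V. \<Sum>x\<in>V. \<Sum>y\<in>V. t v w x y * of_bool (v = y \<and> w = x)) = (\<Sum>v\<in>V. \<Sum>w\<in>V. t v w w v)"
    by (subst sum.swap[of _ V V], simp add: of_bool_conj delta flip: mult.assoc cong: sum.cong)
  show ?thesis by (simp add: distrib_left sum.distrib 1 2 3)
qed

text \<open>Taking \<open>w = v\<close> in \<open>nonanti\<close> excludes the zero vector from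
  \<open>V\<close>, so sums of frequencies, including doubled ones, are nonzero and average out over
  the torus.\<close>

locale toral_waves =
  fixes B :: "real^'n^'n" and V :: "(real^'n) set"
  assumes symB: "transpose B = B"
    and posdefB: "\<And>x. x \<noteq> 0 \<Longrightarrow> innerB B x x > 0"
    and finV: "finite V" and neV: "V \<noteq> {}"
    and intV: "\<And>v i. v \<in> V \<Longrightarrow> (B *v v) $ i \<in> \<int>"
    and nonanti: "\<And>v w. v \<in> V \<Longrightarrow> w \<in> V \<Longrightarrow> v + w \<noteq> 0"
begin

interpretation T: prob_space "torus_unif :: (real^'n) measure" by (rule prob_space_torus_unif)

abbreviation c :: "real^'n \<Rightarrow> real^'n \<Rightarrow> real" where "c \<equiv> innerB B"

definition cs :: "real^'n \<Rightarrow> real^'n \<Rightarrow> real" where "cs v x = cos (2 * pi * ((B *v v) \<bullet> x))"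
definition sn :: "real^'n \<Rightarrow> real^'n \<Rightarrow> real" where "sn v x = sin (2 * pi * ((B *v v) \<bullet> x))"

lemma c_commute: "c v w = c w v"
  unfolding innerB_def by (metis dot_lmul_matrix inner_commute symB transpose_matrix_vector)

lemma B_inj: "B *v v = 0 \<Longrightarrow> v = 0"
  using posdefB[of v] by (auto simp: innerB_def)

lemma B_eq_iff: "B *v v = B *v w \<longleftrightarrow> v = w"
  using B_inj[of "v - w"] by (auto simp: matrix_vector_mult_diff_distrib)

lemma B_add_nz: "v \<in> V \<Longrightarrow> w \<in> V \<Longrightarrow> B *v v + B *v w \<noteq> 0"
  using B_inj[of "v + w"] nonanti[of v w] by (auto simp: matrix_vector_right_distrib)

lemma cs_sn_continuous [continuous_intros]:
  "continuous_on A (cs v)" "continuous_on A (sn v)"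
  unfolding cs_def sn_def by (intro continuous_intros)+

lemma cs_sn_period:
  assumes "v \<in> V"
  shows "cs v (x + axis j 1) = cs v x" "sn v (x + axis j 1) = sn v x"
  using cos_periodic_shift[of "B *v v" x j 0] intV[OF assms] by (auto simp: cs_def sn_def)

text \<open>This is where the metric enters: the phase of \<open>w\<close>, differentiated along
  \<open>v\<close>, yields the inner product \<open>c w v\<close>.\<close>

lemma cs_sn_deriv:
  "((\<lambda>t. cs w (x + t *\<^sub>R v)) has_real_derivative - (2 * pi * c w v * sn w x)) (at 0)"
  "((\<lambda>t. sn w (x + t *\<^sub>R v)) has_real_derivative 2 * pi * c w v * cs w x) (at 0)"
  unfolding cs_def sn_def innerB_def inner_add_right inner_scaleR_right
  by (auto intro!: derivative_eq_intros)

lemma wave_eq: "wave B V a x = (\<Sum>v\<in>V. a v * cs v x)"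
  unfolding wave_def cs_def by (simp add: Re_exp)

lemma wave_continuous [continuous_intros]: "continuous_on A (wave B V a)"
  unfolding wave_eq[abs_def] by (intro continuous_intros)

section \<open>Orthogonality relations for sines and cosines of the wave\<close>

lemma torus_cs_cs:
  assumes "v \<in> V" "w \<in> V"
  shows "(\<integral>x. cs v x * cs w x \<partial>torus_unif) = of_bool (v = w) / 2"
  unfolding cs_def using assms
  by (subst torus_integral_cos_cos) (auto simp: intV B_add_nz B_eq_iff)

text \<open>For \<open>v\<close>, \<open>w\<close> in \<open>V\<close> this is the product of sines
  centred at its torus mean.\<close>

definition u :: "real^'n \<Rightarrow> real^'n \<Rightarrow> real^'n \<Rightarrow> real" where
  "u v w x = sn v x * sn w x - of_bool (v = w) / 2"

lemma u_continuous [continuous_intros]: "continuous_on A (u v w)"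
  unfolding u_def by (intro continuous_intros)

lemma u_commute: "u v w = u w v"
  by (auto simp: u_def fun_eq_iff)

definition cs2 :: "real^'n \<Rightarrow> real^'n \<Rightarrow> real" where "cs2 v x = cos (2 * pi * ((2 *\<^sub>R (B *v v)) \<bullet> x))"

lemma cs2_continuous [continuous_intros]: "continuous_on A (cs2 v)"
  unfolding cs2_def by (intro continuous_intros)

lemma sn_squared: "sn v x * sn v x = (1 - cs2 v x) / 2"
proof -
  have "cs2 v x = 1 - 2 * (sn v x)\<^sup>2"
    unfolding cs2_def sn_def cos_double_sin[symmetric] by (simp add: algebra_simps)
  then show ?thesis by (simp add: power2_eq_square)
qed

lemma int2: "v \<in> V \<Longrightarrow> (2 *\<^sub>R (B *v v)) $ i \<in> \<int>"
  using intV[of v i] by (auto intro!: Ints_mult)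

lemma torus_cs2: "v \<in> V \<Longrightarrow> (\<integral>x. cs2 v x \<partial>torus_unif) = 0"
  unfolding cs2_def using B_add_nz[of v v]
  by (intro torus_integral_cos int2) (auto simp: scaleR_2)

lemma torus_cs2_cs2:
  assumes "v \<in> V" "w \<in> V"
  shows "(\<integral>x. cs2 v x * cs2 w x \<partial>torus_unif) = of_bool (v = w) / 2"
proof -
  have "2 *\<^sub>R (B *v v) + 2 *\<^sub>R (B *v w) \<noteq> 0"
    using B_add_nz[OF assms] by (simp flip: scaleR_add_right)
  then show ?thesis unfolding cs2_def using assms
    by (subst torus_integral_cos_cos) (auto simp: int2 B_eq_iff simp del: vector_scaleR_component)
qed

text \<open>On the diagonal \<open>u v v\<close> is minus half of the cosine \<open>cs2 v\<close>,
  so orthogonality of these cosines applies.\<close>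

lemma torus_u_diag:
  assumes "v \<in> V" "w \<in> V"
  shows "(\<integral>x. u v v x * u w w x \<partial>torus_unif) = of_bool (v = w) / 8"
proof -
  have "u v v x * u w w x = cs2 v x * cs2 w x / 4" for x
    by (simp add: u_def sn_squared field_simps)
  then have "(\<lambda>x. u v v x * u w w x) = (\<lambda>x. cs2 v x * cs2 w x / 4)" by (rule ext)
  then show ?thesis using torus_cs2_cs2[OF assms] by simp
qed

text \<open>Off the diagonal the double-angle formula turns the square into 1/4 plus oscillating
  terms of mean 0; the diagonal value 1/8 is \<open>torus_u_diag\<close>.\<close>

lemma torus_u_square:
  assumes "v \<in> V" "w \<in> V"
  shows "(\<integral>x. u v w x * u v w x \<partial>torus_unif) = 1 / 4 - of_bool (v = w) / 8"
proof (cases "v = w")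
  case False
  have "(\<lambda>x. u v w x * u v w x) = (\<lambda>x. 1 / 4 - cs2 v x / 4 - cs2 w x / 4 + cs2 v x * cs2 w x / 4)"
  proof
    fix x
    have "u v w x * u v w x = (sn v x * sn v x) * (sn w x * sn w x)"
      using False by (simp add: u_def)
    then show "u v w x * u v w x = 1 / 4 - cs2 v x / 4 - cs2 w x / 4 + cs2 v x * cs2 w x / 4"
      unfolding sn_squared by (simp add: field_simps)
  qed
  moreover have "integrable torus_unif (cs2 v)" "integrable torus_unif (cs2 w)"
      "integrable torus_unif (\<lambda>x. cs2 v x * cs2 w x)"
    by (intro torus_integrable_continuous continuous_intros)+
  ultimately show ?thesis
    using False assms by (simp add: torus_cs2 torus_cs2_cs2)
qed (use torus_u_diag[OF assms(1,1)] in simp)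

section \<open>Stein's bound for fixed coefficients\<close>

text \<open>\<open>grad2 a\<close> and \<open>neg_laplacian a\<close> are \<open>\<parallel>\<nabla>f\<parallel>\<^sup>2\<close> and \<open>- \<Delta>f\<close> for the metric \<open>(\<cdot>,\<cdot>)\<^sub>B\<close>
  and \<open>f = wave B V a\<close>.\<close>
definition grad2 :: "(real^'n \<Rightarrow> real) \<Rightarrow> real^'n \<Rightarrow> real" where
  "grad2 a x = (2 * pi)\<^sup>2 * (\<Sum>v\<in>V. \<Sum>w\<in>V. a v * a w * c v w * (sn v x * sn w x))"

definition neg_laplacian :: "(real^'n \<Rightarrow> real) \<Rightarrow> real^'n \<Rightarrow> real" where
  "neg_laplacian a x = (\<Sum>v\<in>V. (2 * pi)\<^sup>2 * c v v * a v * cs v x)"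

lemma grad2_laplacian_continuous [continuous_intros]:
  "continuous_on A (grad2 a)" "continuous_on A (neg_laplacian a)"
  unfolding grad2_def neg_laplacian_def by (intro continuous_intros)+

text \<open>The field \<open>h(f) \<nabla>f\<close> is a combination \<open>- 2 \<pi> \<Sum>\<^sub>v a\<^sub>v h(f) sn\<^sub>v v\<close> of constant vectors, so its
  divergence is obtained by differentiating the coefficient of each \<open>v\<close> along \<open>v\<close>.\<close>
lemma integration_by_parts:
  assumes h: "\<And>y. (h has_real_derivative h' y) (at y)" and h': "continuous_on UNIV h'"
    and hb: "\<And>y. \<bar>h y\<bar> \<le> K"
  shows "(\<integral>x. h' (wave B V a x) * grad2 a x \<partial>torus_unif)
    = (\<integral>x. h (wave B V a x) * neg_laplacian a x \<partial>torus_unif)"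
proof -
  let ?f = "wave B V a"
  have conth: "continuous_on UNIV h" using h by (meson DERIV_continuous_on DERIV_subset subset_UNIV)
  have chf [continuous_intros]: "continuous_on UNIV (\<lambda>x. h (?f x))" "continuous_on UNIV (\<lambda>x. h' (?f x))"
    by (intro continuous_on_compose2[OF conth] continuous_on_compose2[OF h'] continuous_intros; simp)+
  \<comment> \<open>The derivative of \<open>h(f) * sn v\<close> in direction
    \<open>v\<close>.\<close>
  define D where "D v x = h' (?f x) * (\<Sum>w\<in>V. a w * - (2 * pi * c w v * sn w x)) * sn v x
    + h (?f x) * (2 * pi * c v v * cs v x)" for v x
  have contD: "continuous_on UNIV (D v)" for v unfolding D_def by (intro continuous_intros)
  have D0: "(\<integral>x. D v x \<partial>torus_unif) = 0" if v: "v \<in> V" for v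
  proof -
    have contF: "continuous_on UNIV (\<lambda>x. h (?f x) * sn v x)" by (intro continuous_intros)
    interpret periodic "\<lambda>x. h (?f x) * sn v x" K
    proof
      show "(\<lambda>x. h (?f x) * sn v x) \<in> borel_measurable borel"
        by (rule borel_measurable_continuous_onI[OF contF])
      show "\<bar>h (?f x) * sn v x\<bar> \<le> K" for x
        using mult_mono[OF hb[of "?f x"], of "\<bar>sn v x\<bar>" 1] order_trans[OF abs_ge_zero hb]
        by (simp add: abs_mult sn_def)
      show "h (?f (x + axis j 1)) * sn v (x + axis j 1) = h (?f x) * sn v x" for x j
        using v by (simp add: wave_eq cs_sn_period cong: sum.cong)
    qed
    show ?thesis
    proof (rule integral_directional_derivative_zero[OF contF contD])
      fix x
      have "((\<lambda>t. ?f (x + t *\<^sub>R v)) has_real_derivative (\<Sum>w\<in>V. a w * - (2 * pi * c w v * sn w x))) (at 0)"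
        unfolding wave_eq by (intro DERIV_sum DERIV_cmult cs_sn_deriv)
      then have "((\<lambda>t. h (?f (x + t *\<^sub>R v))) has_real_derivative
          h' (?f (x + 0 *\<^sub>R v)) * (\<Sum>w\<in>V. a w * - (2 * pi * c w v * sn w x))) (at 0)"
        by (intro DERIV_chain2[OF h]) simp
      from DERIV_mult[OF this cs_sn_deriv(2)[of v x v]]
      show "((\<lambda>t. h (?f (x + t *\<^sub>R v)) * sn v (x + t *\<^sub>R v)) has_real_derivative D v x) (at 0)"
        by (simp add: D_def algebra_simps)
    qed
  qed
  \<comment> \<open>The weighted sum of the \<open>D v\<close> is minus the divergence of
    \<open>h(f)\<close> times the gradient of \<open>f\<close>.\<close>
  have "(\<integral>x. h (?f x) * neg_laplacian a x - h' (?f x) * grad2 a x \<partial>torus_unif)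
      = (\<integral>x. (\<Sum>v\<in>V. 2 * pi * a v * D v x) \<partial>torus_unif)"
  proof (intro Bochner_Integration.integral_cong refl)
    fix x
    have "(\<Sum>v\<in>V. 2 * pi * a v * D v x)
        = (\<Sum>v\<in>V. h (?f x) * ((2 * pi)\<^sup>2 * c v v * a v * cs v x))
          + (\<Sum>v\<in>V. 2 * pi * a v * (h' (?f x) * (\<Sum>w\<in>V. a w * - (2 * pi * c w v * sn w x)) * sn v x))"
      unfolding D_def sum.distrib[symmetric]
      by (intro sum.cong) (auto simp: power2_eq_square algebra_simps)
    also have "(\<Sum>v\<in>V. 2 * pi * a v * (h' (?f x) * (\<Sum>w\<in>V. a w * - (2 * pi * c w v * sn w x)) * sn v x))
        = - (h' (?f x) * grad2 a x)"
      unfolding grad2_def sum_distrib_left sum_distrib_right sum_negf[symmetric]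
      by (intro sum.cong refl) (simp add: c_commute power2_eq_square algebra_simps)
    finally show "h (?f x) * neg_laplacian a x - h' (?f x) * grad2 a x = (\<Sum>v\<in>V. 2 * pi * a v * D v x)"
      by (simp add: neg_laplacian_def sum_distrib_left)
  qed
  also have "\<dots> = (\<Sum>v\<in>V. 2 * pi * a v * (\<integral>x. D v x \<partial>torus_unif))"
    by (subst Bochner_Integration.integral_sum) (auto intro!: torus_integrable_continuous continuous_intros contD)
  also have "\<dots> = 0" by (simp add: D0)
  finally show ?thesis
    by (subst (asm) Bochner_Integration.integral_diff)
      (auto intro!: torus_integrable_continuous continuous_intros)
qed

text \<open>Stein's equation replaces each test function by \<open>h\<close> and \<open>h'\<close>;
  the coefficients 2 and \<open>sqrt (2 * pi)\<close> are the uniform bounds on \<open>h'\<close>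
  and \<open>h\<close>.\<close>

lemma dTV_wave_le:
  assumes \<mu>: "\<mu> > 0"
  shows "\<mu> * dTV (distr torus_unif borel (wave B V a)) std_gaussian
    \<le> 2 * (\<integral>x. \<bar>grad2 a x - \<mu>\<bar> \<partial>torus_unif)
      + sqrt (2 * pi) * (\<integral>x. \<bar>neg_laplacian a x - \<mu> * wave B V a x\<bar> \<partial>torus_unif)"
    (is "_ \<le> ?C")
proof -
  let ?f = "wave B V a"
  have meas [measurable]: "?f \<in> borel_measurable borel"
    by (intro borel_measurable_continuous_onI continuous_intros)
  have "dTV (distr torus_unif borel ?f) std_gaussian \<le> ?C / \<mu>"
  proof (rule dTV_le_continuous)
    show "prob_space (distr torus_unif borel ?f)" by (rule T.prob_space_distr) simp
    show "prob_space std_gaussian" unfolding std_gaussian_def by (rule prob_space_normal_density) simp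
    show "sets std_gaussian = sets borel" by (simp add: std_gaussian_def)
    fix g :: "real \<Rightarrow> real" assume g: "continuous_on UNIV g" and g01: "\<And>x. 0 \<le> g x \<and> g x \<le> 1"
    obtain h h' where h': "continuous_on UNIV h'" and h: "\<And>x. (h has_real_derivative h' x) (at x)"
      and stein: "\<And>x. h' x - x * h x = g x - (\<integral>t. g t \<partial>std_gaussian)"
      and hb: "\<And>x. \<bar>h x\<bar> \<le> sqrt (2 * pi)" and hb': "\<And>x. \<bar>h' x\<bar> \<le> 2"
      using stein_solution[OF g] g01 by metis
    have conth: "continuous_on UNIV h" using h by (meson DERIV_continuous_on DERIV_subset subset_UNIV)
    have [continuous_intros]: "continuous_on UNIV (\<lambda>x. h (?f x))" "continuous_on UNIV (\<lambda>x. h' (?f x))"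
      "continuous_on UNIV (\<lambda>x. g (?f x))"
      by (intro continuous_on_compose2[OF conth] continuous_on_compose2[OF h']
          continuous_on_compose2[OF g] continuous_intros; simp)+
    note int = torus_integrable_continuous
    have "\<mu> * ((\<integral>x. g x \<partial>distr torus_unif borel ?f) - (\<integral>x. g x \<partial>std_gaussian))
        = (\<integral>x. \<mu> * (g (?f x) - (\<integral>t. g t \<partial>std_gaussian)) \<partial>torus_unif)"
      using borel_measurable_continuous_onI[OF g]
      by (simp add: integral_distr int continuous_intros)
    \<comment> \<open>Gradient and Laplacian terms are added and subtracted so that the last bracket
      integrates to 0 by parts.\<close>
    also have "\<dots> = (\<integral>x. (h' (?f x) * (\<mu> - grad2 a x) + h (?f x) * (neg_laplacian a x - \<mu> * ?f x))
        + (h' (?f x) * grad2 a x - h (?f x) * neg_laplacian a x) \<partial>torus_unif)"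
      by (intro Bochner_Integration.integral_cong refl, subst stein[symmetric]) (simp add: algebra_simps)
    also have "\<dots> = (\<integral>x. h' (?f x) * (\<mu> - grad2 a x) + h (?f x) * (neg_laplacian a x - \<mu> * ?f x) \<partial>torus_unif)
        + (\<integral>x. h' (?f x) * grad2 a x - h (?f x) * neg_laplacian a x \<partial>torus_unif)"
      by (intro Bochner_Integration.integral_add int continuous_intros)
    also have "(\<integral>x. h' (?f x) * grad2 a x - h (?f x) * neg_laplacian a x \<partial>torus_unif) = 0"
      by (subst Bochner_Integration.integral_diff)
        (auto intro!: int continuous_intros simp: integration_by_parts[OF h h' hb])
    finally have "\<bar>\<mu> * ((\<integral>x. g x \<partial>distr torus_unif borel ?f) - (\<integral>x. g x \<partial>std_gaussian))\<bar>
        = \<bar>\<integral>x. h' (?f x) * (\<mu> - grad2 a x) + h (?f x) * (neg_laplacian a x - \<mu> * ?f x) \<partial>torus_unif\<bar>" by simp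
    also have "\<dots> \<le> (\<integral>x. \<bar>h' (?f x) * (\<mu> - grad2 a x) + h (?f x) * (neg_laplacian a x - \<mu> * ?f x)\<bar> \<partial>torus_unif)"
      by (rule integral_abs_bound)
    also have "\<dots> \<le> (\<integral>x. 2 * \<bar>grad2 a x - \<mu>\<bar> + sqrt (2 * pi) * \<bar>neg_laplacian a x - \<mu> * ?f x\<bar> \<partial>torus_unif)"
    proof (intro integral_mono int continuous_intros)
      fix x
      have "\<bar>h' (?f x) * (\<mu> - grad2 a x)\<bar> \<le> 2 * \<bar>grad2 a x - \<mu>\<bar>"
        unfolding abs_mult using hb'[of "?f x"] by (subst abs_minus_commute) (intro mult_right_mono; simp)
      moreover have "\<bar>h (?f x) * (neg_laplacian a x - \<mu> * ?f x)\<bar> \<le> sqrt (2 * pi) * \<bar>neg_laplacian a x - \<mu> * ?f x\<bar>"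
        unfolding abs_mult using hb[of "?f x"] by (intro mult_right_mono; simp)
      ultimately show "\<bar>h' (?f x) * (\<mu> - grad2 a x) + h (?f x) * (neg_laplacian a x - \<mu> * ?f x)\<bar>
          \<le> 2 * \<bar>grad2 a x - \<mu>\<bar> + sqrt (2 * pi) * \<bar>neg_laplacian a x - \<mu> * ?f x\<bar>" by linarith
    qed
    also have "\<dots> = ?C"
      by (subst Bochner_Integration.integral_add) (auto intro!: int continuous_intros)
    finally show "\<bar>(\<integral>x. g x \<partial>distr torus_unif borel ?f) - (\<integral>x. g x \<partial>std_gaussian)\<bar> \<le> ?C / \<mu>"
      using \<mu> by (simp add: abs_mult pos_le_divide_eq mult.commute)
  qed simp
  then show ?thesis using \<mu> by (simp add: pos_le_divide_eq mult.commute)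
qed

section \<open>Second-moment bounds over the torus\<close>

text \<open>\<open>W a\<close> is the variance of \<open>grad2 a\<close> over the torus: the subtracted term is its mean.\<close>
definition W :: "(real^'n \<Rightarrow> real) \<Rightarrow> real" where
  "W a = (\<integral>x. (grad2 a x - (2 * pi)\<^sup>2 * (\<Sum>v\<in>V. (a v)\<^sup>2 * c v v) / 2)\<^sup>2 \<partial>torus_unif)"

text \<open>The torus mean square of \<open>neg_laplacian a x - \<mu> * wave B V a x\<close>; the
  factor 1/2 is the mean of a squared cosine.\<close>

definition U :: "real \<Rightarrow> (real^'n \<Rightarrow> real) \<Rightarrow> real" where
  "U \<mu> a = (\<Sum>v\<in>V. (a v)\<^sup>2 * ((2 * pi)\<^sup>2 * c v v - \<mu>)\<^sup>2) / 2"

lemma torus_abs_laplacian_le: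
  "(\<integral>x. \<bar>neg_laplacian a x - \<mu> * wave B V a x\<bar> \<partial>torus_unif) \<le> sqrt (U \<mu> a)"
proof -
  let ?e = "\<lambda>v. a v * ((2 * pi)\<^sup>2 * c v v - \<mu>)"
  have eq: "neg_laplacian a x - \<mu> * wave B V a x = (\<Sum>v\<in>V. ?e v * cs v x)" for x
    unfolding neg_laplacian_def wave_eq sum_distrib_left sum_subtractf[symmetric]
    by (intro sum.cong) (auto simp: algebra_simps)
  have cont: "continuous_on UNIV (\<lambda>x. (\<Sum>v\<in>V. ?e v * cs v x)\<^sup>2)" by (intro continuous_intros)
  have "(\<integral>x. (\<Sum>v\<in>V. ?e v * cs v x)\<^sup>2 \<partial>torus_unif)
      = (\<integral>x. (\<Sum>v\<in>V. \<Sum>w\<in>V. ?e v * ?e w * (cs v x * cs w x)) \<partial>torus_unif)"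
    unfolding power2_eq_square sum_product
    by (intro Bochner_Integration.integral_cong sum.cong refl) (simp add: algebra_simps)
  also have "\<dots> = (\<Sum>v\<in>V. \<Sum>w\<in>V. ?e v * ?e w * (\<integral>x. cs v x * cs w x \<partial>torus_unif))"
    by (subst Bochner_Integration.integral_sum, intro torus_integrable_continuous continuous_intros,
        intro sum.cong refl, subst Bochner_Integration.integral_sum)
      (auto intro!: torus_integrable_continuous continuous_intros)
  also have "\<dots> = (\<Sum>v\<in>V. \<Sum>w\<in>V. if v = w then ?e v * ?e v / 2 else 0)"
    by (intro sum.cong refl) (auto simp: torus_cs_cs)
  also have "\<dots> = U \<mu> a"
    using finV by (simp add: U_def power2_eq_square sum_divide_distrib algebra_simps)
  finally have "(\<integral>x. (\<Sum>v\<in>V. ?e v * cs v x)\<^sup>2 \<partial>torus_unif) = U \<mu> a" .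
  then show ?thesis
    using T.expectation_sqrt_le(2)[OF torus_integrable_continuous[OF cont]] by (simp add: eq)
qed

text \<open>The triangle inequality through the torus mean of \<open>grad2 a\<close>: the
  fluctuation is bounded by its standard deviation, and the mean differs from \<open>\<mu>\<close>
  by a weighted average of the eigenvalue errors.\<close>

lemma torus_abs_grad2_le:
  assumes norm: "(\<Sum>v\<in>V. (a v)\<^sup>2) = 2"
  shows "(\<integral>x. \<bar>grad2 a x - \<mu>\<bar> \<partial>torus_unif)
    \<le> sqrt (W a) + (\<Sum>v\<in>V. (a v)\<^sup>2 * \<bar>(2 * pi)\<^sup>2 * c v v - \<mu>\<bar>) / 2"
proof -
  define m where "m = (2 * pi)\<^sup>2 * (\<Sum>v\<in>V. (a v)\<^sup>2 * c v v) / 2"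
  \<comment> \<open>The normalisation makes the \<open>(a v)\<^sup>2 / 2\<close> weights of total
    mass 1, so \<open>\<mu>\<close> can be moved inside the sum.\<close>
  have "m - \<mu> = (2 * pi)\<^sup>2 * (\<Sum>v\<in>V. (a v)\<^sup>2 * c v v) / 2 - \<mu> * (\<Sum>v\<in>V. (a v)\<^sup>2) / 2"
    by (simp add: m_def norm)
  also have "\<dots> = (\<Sum>v\<in>V. (a v)\<^sup>2 * ((2 * pi)\<^sup>2 * c v v - \<mu>)) / 2"
    unfolding sum_distrib_left diff_divide_distrib[symmetric] sum_subtractf[symmetric]
    by (intro arg_cong2[where f = "(/)"] sum.cong refl) (simp add: algebra_simps)
  also have "\<bar>\<dots>\<bar> \<le> (\<Sum>v\<in>V. \<bar>(a v)\<^sup>2 * ((2 * pi)\<^sup>2 * c v v - \<mu>)\<bar>) / 2"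
    by (simp add: sum_abs)
  finally have m: "\<bar>m - \<mu>\<bar> \<le> (\<Sum>v\<in>V. (a v)\<^sup>2 * \<bar>(2 * pi)\<^sup>2 * c v v - \<mu>\<bar>) / 2"
    by (simp add: abs_mult)
  have "(\<integral>x. \<bar>grad2 a x - \<mu>\<bar> \<partial>torus_unif) \<le> (\<integral>x. \<bar>grad2 a x - m\<bar> + \<bar>m - \<mu>\<bar> \<partial>torus_unif)"
    by (intro integral_mono torus_integrable_continuous continuous_intros) linarith
  also have "\<dots> = (\<integral>x. \<bar>grad2 a x - m\<bar> \<partial>torus_unif) + \<bar>m - \<mu>\<bar>"
    by (subst Bochner_Integration.integral_add)
      (auto intro!: torus_integrable_continuous continuous_intros)
  also have "(\<integral>x. \<bar>grad2 a x - m\<bar> \<partial>torus_unif) \<le> sqrt (W a)"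
    using T.expectation_sqrt_le(2)[of "\<lambda>x. (grad2 a x - m)\<^sup>2"]
    by (simp add: W_def m_def torus_integrable_continuous continuous_intros)
  finally show ?thesis using m by linarith
qed

lemma W_nonneg: "0 \<le> W a"
  unfolding W_def by (intro integral_nonneg_AE) auto

lemma U_nonneg: "0 \<le> U \<mu> a"
  unfolding U_def by (auto intro!: sum_nonneg divide_nonneg_nonneg)

text \<open>Subtracting the mean replaces products of sines by \<open>u\<close>; the square is then
  a quartic form in \<open>a\<close>, ready for \<open>moment4\<close>.\<close>

lemma W_eq: "W a = (2 * pi) ^ 4 * (\<Sum>v\<in>V. \<Sum>w\<in>V. \<Sum>x\<in>V. \<Sum>y\<in>V.
    c v w * c x y * (\<integral>z. u v w z * u x y z \<partial>torus_unif) * (a v * a w * a x * a y))"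
proof -
  let ?t = "\<lambda>z v w. a v * a w * c v w * u v w z"
  have eq: "grad2 a z - (2 * pi)\<^sup>2 * (\<Sum>v\<in>V. (a v)\<^sup>2 * c v v) / 2 = (2 * pi)\<^sup>2 * (\<Sum>v\<in>V. \<Sum>w\<in>V. ?t z v w)" for z
  proof -
    have "(\<Sum>v\<in>V. \<Sum>w\<in>V. ?t z v w) = (\<Sum>v\<in>V. \<Sum>w\<in>V. a v * a w * c v w * (sn v z * sn w z)
        - (if v = w then (a v)\<^sup>2 * c v v / 2 else 0))"
      by (intro sum.cong refl) (auto simp: u_def power2_eq_square algebra_simps)
    also have "\<dots> = (\<Sum>v\<in>V. \<Sum>w\<in>V. a v * a w * c v w * (sn v z * sn w z)) - (\<Sum>v\<in>V. (a v)\<^sup>2 * c v v / 2)"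
      using finV by (simp add: sum_subtractf)
    finally show ?thesis by (simp add: grad2_def right_diff_distrib sum_divide_distrib[symmetric])
  qed
  have sq: "(\<Sum>v\<in>V. \<Sum>w\<in>V. ?t z v w)\<^sup>2
      = (\<Sum>v\<in>V. \<Sum>w\<in>V. \<Sum>x\<in>V. \<Sum>y\<in>V. c v w * c x y * (a v * a w * a x * a y) * (u v w z * u x y z))" for z
    unfolding power2_eq_square sum_distrib_left sum_distrib_right
    by (intro sum.cong refl) (simp add: algebra_simps)
  have int_sum: "(\<integral>z. (\<Sum>v\<in>V. f v z) \<partial>torus_unif) = (\<Sum>v\<in>V. \<integral>z. f v z \<partial>torus_unif)"
    if "\<And>v. continuous_on UNIV (f v)" for f :: "real^'n \<Rightarrow> real^'n \<Rightarrow> real"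
    by (intro Bochner_Integration.integral_sum torus_integrable_continuous that)
  have "W a = (2 * pi) ^ 4 * (\<integral>z. (\<Sum>v\<in>V. \<Sum>w\<in>V. ?t z v w)\<^sup>2 \<partial>torus_unif)"
    unfolding W_def eq power_mult_distrib[of "(2 * pi)\<^sup>2"] by (simp flip: power_mult)
  also have "(\<integral>z. (\<Sum>v\<in>V. \<Sum>w\<in>V. ?t z v w)\<^sup>2 \<partial>torus_unif) = (\<Sum>v\<in>V. \<Sum>w\<in>V. \<Sum>x\<in>V. \<Sum>y\<in>V.
      c v w * c x y * (\<integral>z. u v w z * u x y z \<partial>torus_unif) * (a v * a w * a x * a y))"
    unfolding sq by (simp add: int_sum continuous_intros) (simp add: algebra_simps)
  finally show ?thesis .
qed

section \<open>Averaging over the random coefficients\<close>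

interpretation S: finite_sphere V "sqrt 2"
  by standard (rule finV neV)+

lemma expectation_W:
  shows "integrable S.S W"
    and "(\<integral>a. W a \<partial>S.S) \<le> 2 * (2 * pi) ^ 4 / (card V * (card V + 2)) * (\<Sum>v\<in>V. \<Sum>w\<in>V. (c v w)\<^sup>2)"
proof -
  let ?e = "\<lambda>v w x y. \<integral>z. u v w z * u x y z \<partial>torus_unif"
  let ?q = "4 / (real (card V) * (real (card V) + 2))"
  have r4: "sqrt 2 ^ 4 = (4::real)" by (simp add: power4_eq_xxxx)
  have int: "integrable S.S (\<lambda>a. k * (a v * a w * a x * a y))"
    if "v \<in> V" "w \<in> V" "x \<in> V" "y \<in> V" for v w x y k
    by (intro integrable_mult_right S.integrable_S_prod4 that)
  show "integrable S.S W"
    unfolding W_eq[abs_def] by (intro integrable_mult_right Bochner_Integration.integrable_sum int)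
  have "(\<integral>a. W a \<partial>S.S) = (2 * pi) ^ 4 * (\<Sum>v\<in>V. \<Sum>w\<in>V. \<Sum>x\<in>V. \<Sum>y\<in>V.
      c v w * c x y * ?e v w x y * (\<integral>a. a v * a w * a x * a y \<partial>S.S))"
    unfolding W_eq
    by (simp add: S.integrable_S_prod4)
  also have "\<dots> = (2 * pi) ^ 4 * (?q * (\<Sum>v\<in>V. \<Sum>w\<in>V. \<Sum>x\<in>V. \<Sum>y\<in>V. c v w * c x y * ?e v w x y *
      (of_bool (v = w \<and> x = y) + of_bool (v = x \<and> w = y) + of_bool (v = y \<and> w = x))))"
    unfolding sum_distrib_left[of ?q]
    by (rule arg_cong[where f = "(*) ((2 * pi) ^ 4)"], intro sum.cong refl,
        simp only: S.moment4 r4) (simp only: mult_ac of_nat_mult of_nat_add of_nat_numeral)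
  also have "(\<Sum>v\<in>V. \<Sum>w\<in>V. \<Sum>x\<in>V. \<Sum>y\<in>V. c v w * c x y * ?e v w x y *
      (of_bool (v = w \<and> x = y) + of_bool (v = x \<and> w = y) + of_bool (v = y \<and> w = x)))
      = (\<Sum>v\<in>V. \<Sum>x\<in>V. c v v * c x x * ?e v v x x) + (\<Sum>v\<in>V. \<Sum>w\<in>V. c v w * c v w * ?e v w v w)
        + (\<Sum>v\<in>V. \<Sum>w\<in>V. c v w * c w v * ?e v w w v)"
    by (rule sum_pairings[OF finV])
  \<comment> \<open>With delta the indicator of \<open>v = w\<close>, the first pairing contributes
    delta/8 and each of the other two 1/4 - delta/8, in units of
    \<open>(c v w)\<^sup>2\<close>.\<close>
  also have "\<dots> = (\<Sum>v\<in>V. \<Sum>w\<in>V. (c v w)\<^sup>2 / 2 - (if v = w then (c v w)\<^sup>2 / 8 else 0))"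
    unfolding sum.distrib[symmetric]
  proof (intro sum.cong refl)
    fix v w assume vw: "v \<in> V" "w \<in> V"
    have e: "?e v w w v = ?e v w v w" by (simp add: u_commute[of w v])
    show "c v v * c w w * ?e v v w w + c v w * c v w * ?e v w v w + c v w * c w v * ?e v w w v
        = (c v w)\<^sup>2 / 2 - (if v = w then (c v w)\<^sup>2 / 8 else 0)"
      unfolding e torus_u_diag[OF vw] torus_u_square[OF vw] c_commute[of w v]
      by (cases "v = w") (simp_all add: power2_eq_square)
  qed
  \<comment> \<open>The nonpositive diagonal correction is dropped.\<close>
  also have "(2 * pi) ^ 4 * (?q * \<dots>) \<le> (2 * pi) ^ 4 * (?q * (\<Sum>v\<in>V. \<Sum>w\<in>V. (c v w)\<^sup>2 / 2))"
    by (intro mult_left_mono sum_mono) auto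
  also have "\<dots> = 2 * (2 * pi) ^ 4 / (card V * (card V + 2)) * (\<Sum>v\<in>V. \<Sum>w\<in>V. (c v w)\<^sup>2)"
    by (simp add: sum_divide_distrib[symmetric] algebra_simps)
  finally show "(\<integral>a. W a \<partial>S.S) \<le> \<dots>" .
qed

text \<open>Serves both the mean error \<open>L\<close> and \<open>U\<close>: on the sphere of
  radius \<open>sqrt 2\<close> the second moment is \<open>2 / card V\<close>, and halving leaves a
  plain average.\<close>

lemma expectation_weighted_squares:
  shows "integrable S.S (\<lambda>a. (\<Sum>v\<in>V. (a v)\<^sup>2 * d v) / 2)"
    and "(\<integral>a. (\<Sum>v\<in>V. (a v)\<^sup>2 * d v) / 2 \<partial>S.S) = 1 / card V * (\<Sum>v\<in>V. d v)"
proof -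
  have int: "integrable S.S (\<lambda>a. (a v)\<^sup>2)" if "v \<in> V" for v
    unfolding power2_eq_square by (intro S.integrable_S_prod2 that)
  show "integrable S.S (\<lambda>a. (\<Sum>v\<in>V. (a v)\<^sup>2 * d v) / 2)"
    by (intro integrable_divide Bochner_Integration.integrable_sum integrable_mult_left int) auto
  have "(\<integral>a. (\<Sum>v\<in>V. (a v)\<^sup>2 * d v) / 2 \<partial>S.S) = (\<Sum>v\<in>V. (\<integral>a. (a v)\<^sup>2 * d v \<partial>S.S)) / 2"
    by (simp add: int)
  also have "\<dots> = (\<Sum>v\<in>V. 2 / card V * d v) / 2"
    by (intro arg_cong2[where f = "(/)"] sum.cong refl) (simp add: S.moment2 power2_eq_square)
  also have "\<dots> = 1 / card V * (\<Sum>v\<in>V. d v)"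
    unfolding sum_distrib_left[symmetric] by simp
  finally show "(\<integral>a. (\<Sum>v\<in>V. (a v)\<^sup>2 * d v) / 2 \<partial>S.S) = 1 / card V * (\<Sum>v\<in>V. d v)" .
qed

lemma expected_dTV_wave_le:
  assumes \<mu>: "\<mu> > 0"
  shows "(\<integral>\<^sup>+ a. ennreal (dTV (distr torus_unif borel (wave B V a)) std_gaussian) \<partial>S.S)
    \<le> ennreal (1 / \<mu> *
      (sqrt (8 * (2 * pi) ^ 4 / (real (card V) * (real (card V) + 2)) * (\<Sum>v\<in>V. \<Sum>w\<in>V. (c v w)\<^sup>2))
        + (2 * sqrt 2 + sqrt pi) * sqrt (1 / real (card V) * (\<Sum>v\<in>V. ((2 * pi) ^ 2 * c v v - \<mu>)\<^sup>2))))"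
    (is "_ \<le> ennreal (1 / \<mu> * (sqrt ?A + ?k * sqrt ?D))")
proof -
  interpret SP: prob_space S.S by (rule S.prob_space_S)
  let ?d = "\<lambda>v. (2 * pi)\<^sup>2 * c v v - \<mu>"
  define L where "L a = (\<Sum>v\<in>V. (a v)\<^sup>2 * \<bar>?d v\<bar>) / 2" for a
  \<comment> \<open>An integrable majorant of the distance; its expectation is estimated
    first.\<close>
  define b where "b a = 1 / \<mu> * (2 * (sqrt (W a) + L a) + sqrt (2 * pi) * sqrt (U \<mu> a))" for a
  have intL: "integrable S.S L" and EL: "SP.expectation L = 1 / card V * (\<Sum>v\<in>V. \<bar>?d v\<bar>)"
    unfolding L_def[abs_def] by (rule expectation_weighted_squares)+
  have intU: "integrable S.S (U \<mu>)" and EU: "SP.expectation (U \<mu>) = ?D"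
    unfolding U_def[abs_def] by (rule expectation_weighted_squares)+
  note sW = SP.expectation_sqrt_le[OF expectation_W(1) W_nonneg]
  note sU = SP.expectation_sqrt_le[OF intU U_nonneg]
  have intb: "integrable S.S b" unfolding b_def[abs_def]
    by (intro integrable_mult_right Bochner_Integration.integrable_add sW sU intL)
  have b_nonneg: "0 \<le> b a" for a
    unfolding b_def L_def using \<mu> W_nonneg[of a] U_nonneg[of \<mu> a]
    by (intro mult_nonneg_nonneg add_nonneg_nonneg divide_nonneg_nonneg sum_nonneg) auto
  have "2 * SP.expectation (\<lambda>a. sqrt (W a)) \<le> 2 * sqrt (SP.expectation W)" using sW(2) by simp
  also have "\<dots> \<le> 2 * sqrt (2 * (2 * pi) ^ 4 / (card V * (card V + 2)) * (\<Sum>v\<in>V. \<Sum>w\<in>V. (c v w)\<^sup>2))"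
    using expectation_W(2) by simp
  \<comment> \<open>The outer 2, the bound on \<open>h'\<close>, enters squared, and 4 times the 2
    from \<open>expectation_W\<close> is the constant 8.\<close>
  also have "\<dots> = sqrt (2\<^sup>2 * (2 * (2 * pi) ^ 4 / (card V * (card V + 2)) * (\<Sum>v\<in>V. \<Sum>w\<in>V. (c v w)\<^sup>2)))"
    unfolding real_sqrt_mult[of "2\<^sup>2"] by simp
  also have "\<dots> = sqrt ?A" by (simp add: algebra_simps)
  finally have W_le: "2 * SP.expectation (\<lambda>a. sqrt (W a)) \<le> sqrt ?A" .
  have cardpos: "real (card V) > 0" using finV neV by (simp add: card_gt_0_iff)
  \<comment> \<open>Cauchy-Schwarz: the mean absolute error is at most the root mean square
    error.\<close>
  have L_le: "SP.expectation L \<le> sqrt ?D"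
  proof (rule real_le_rsqrt)
    have "(SP.expectation L)\<^sup>2 = 1 / (card V)\<^sup>2 * (\<Sum>v\<in>V. \<bar>?d v\<bar>)\<^sup>2"
      by (simp add: EL power_mult_distrib power_divide)
    also have "\<dots> \<le> 1 / (card V)\<^sup>2 * ((\<Sum>v\<in>V. (?d v)\<^sup>2) * card V)"
      using sum_squared_le_sum_of_squares[of "\<lambda>v. \<bar>?d v\<bar>" V] by (intro mult_left_mono) auto
    also have "\<dots> = ?D" using cardpos by (simp add: power2_eq_square)
    finally show "(SP.expectation L)\<^sup>2 \<le> ?D" .
  qed
  have D0: "0 \<le> ?D" by (intro mult_nonneg_nonneg sum_nonneg) simp_all
  \<comment> \<open>Equivalent to \<open>(sqrt 2 - 1) * sqrt pi <= (sqrt 2 - 1) * 2\<close>, that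
    is, to \<open>pi <= 4\<close>.\<close>
  have const: "2 + sqrt (2 * pi) \<le> ?k"
  proof -
    have "sqrt pi \<le> sqrt 4" using pi_less_4 by (intro real_sqrt_le_mono) simp
    then have "(sqrt 2 - 1) * sqrt pi \<le> (sqrt 2 - 1) * 2" by (intro mult_left_mono) auto
    then show ?thesis by (simp add: real_sqrt_mult algebra_simps)
  qed
  have "SP.expectation b = 1 / \<mu> * (2 * SP.expectation (\<lambda>a. sqrt (W a)) + 2 * SP.expectation L
      + sqrt (2 * pi) * SP.expectation (\<lambda>a. sqrt (U \<mu> a)))"
    unfolding b_def[abs_def] using sW(1) sU(1) intL by simp
  also have "\<dots> \<le> 1 / \<mu> * (sqrt ?A + 2 * sqrt ?D + sqrt (2 * pi) * sqrt ?D)"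
    using \<mu> W_le L_le sU(2) unfolding EU
    by (intro mult_left_mono add_mono) auto
  also have "\<dots> = 1 / \<mu> * (sqrt ?A + (2 + sqrt (2 * pi)) * sqrt ?D)" by (simp only: distrib_right add.assoc)
  also have "\<dots> \<le> 1 / \<mu> * (sqrt ?A + ?k * sqrt ?D)"
    using \<mu> const D0 by (intro mult_left_mono add_left_mono mult_right_mono real_sqrt_ge_zero) auto
  finally have Eb: "SP.expectation b \<le> 1 / \<mu> * (sqrt ?A + ?k * sqrt ?D)" .
  have "(\<integral>\<^sup>+ a. ennreal (dTV (distr torus_unif borel (wave B V a)) std_gaussian) \<partial>S.S) \<le> (\<integral>\<^sup>+ a. ennreal (b a) \<partial>S.S)"
  \<comment> \<open>Monotonicity of the nonnegative integral holds for arbitrary integrands, so a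
    bound by \<open>b\<close> at almost every \<open>a\<close> suffices.\<close>
  proof (rule nn_integral_mono_AE)
    show "AE a in S.S. ennreal (dTV (distr torus_unif borel (wave B V a)) std_gaussian) \<le> ennreal (b a)"
      using S.AE_S_norm
    proof eventually_elim
      case (elim a)
      then have norm: "(\<Sum>v\<in>V. (a v)\<^sup>2) = 2" by simp
      have "\<mu> * dTV (distr torus_unif borel (wave B V a)) std_gaussian
          \<le> 2 * (\<integral>x. \<bar>grad2 a x - \<mu>\<bar> \<partial>torus_unif)
            + sqrt (2 * pi) * (\<integral>x. \<bar>neg_laplacian a x - \<mu> * wave B V a x\<bar> \<partial>torus_unif)"
        by (rule dTV_wave_le[OF \<mu>])
      also have "\<dots> \<le> 2 * (sqrt (W a) + L a) + sqrt (2 * pi) * sqrt (U \<mu> a)"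
        unfolding L_def by (intro add_mono mult_left_mono torus_abs_laplacian_le torus_abs_grad2_le norm) auto
      finally have "dTV (distr torus_unif borel (wave B V a)) std_gaussian
          \<le> (2 * (sqrt (W a) + L a) + sqrt (2 * pi) * sqrt (U \<mu> a)) / \<mu>"
        using \<mu> by (subst pos_le_divide_eq) (simp_all only: mult.commute)
      then show ?case unfolding b_def by (intro ennreal_leI) simp
    qed
  qed
  also have "\<dots> = ennreal (SP.expectation b)"
    by (rule nn_integral_eq_integral[OF intb]) (simp add: b_nonneg)
  also have "\<dots> \<le> ennreal (1 / \<mu> * (sqrt ?A + ?k * sqrt ?D))" by (rule ennreal_leI[OF Eb])
  finally show ?thesis .
qed

end

theorem theorem4p1:
  fixes B :: "real^'n^'n" and V :: "(real^'n) set" and \<mu> :: real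
  assumes symB: "transpose B = B"
    and posdefB: "\<And>x. x \<noteq> 0 \<Longrightarrow> innerB B x x > 0"
    and finV: "finite V" and neV: "V \<noteq> {}"
    and intV: "\<And>v i. v \<in> V \<Longrightarrow> (B *v v) $ i \<in> \<int>"
    and nonanti: "\<And>v w. v \<in> V \<Longrightarrow> w \<in> V \<Longrightarrow> v + w \<noteq> 0"
    and mupos: "\<mu> > 0"
  shows "(\<integral>\<^sup>+ a. ennreal (dTV (distr torus_unif borel (wave B V a)) std_gaussian)
            \<partial>(sphere_unif V (sqrt 2)))
         \<le> ennreal (1 / \<mu> *
             (sqrt (8 * (2 * pi) ^ 4 / (real (card V) * (real (card V) + 2))
                     * (\<Sum>v\<in>V. \<Sum>w\<in>V. (innerB B v w)\<^sup>2))
              + (2 * sqrt 2 + sqrt pi)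
                * sqrt (1 / real (card V)
                     * (\<Sum>v\<in>V. ((2 * pi) ^ 2 * innerB B v v - \<mu>)\<^sup>2))))"
proof -
  interpret toral_waves B V
    by unfold_locales (fact symB posdefB finV neV intV nonanti)+
  show ?thesis by (rule expected_dTV_wave_le[OF mupos])
qed

end
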